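(* Let $(\mathfrak g,B,\omega)$ be a non-null even-quadratic odd-symplectic Lie superalgebra. Then $\mathfrak g$ is obtained from $\{0\}$ by a finite sequence of generalized double extensions by the two-dimensional abelian Lie superalgebra.
   Context: All Lie superalgebras are finite dimensional over an algebraically closed field $\mathbb K$ of characteristic zero; $|x|\in\mathbb Z_2$ is the degree of a homogeneous $X$; "non-null" means nonzero. A bilinear form $\theta$ is even if $\theta(\mathfrak g_\alpha,\mathfrak g_\beta)=\{0\}$ for $\alpha\ne\beta$, odd if $\theta(\mathfrak g_\alpha,\mathfrak g_\alpha)=\{0\}$ for all $\alpha$. An even-invariant scalar product $B$ is an even, supersymmetric ($B(X,Y)=(-1)^{|x||y|}B(Y,X)$), invariant ($B([X,Y],Z)=B(X,[Y,Z])$), non-degenerate bilinear form. An odd-symplectic form is an odd, skew-supersymmetric ($\omega(X,Y)=-(-1)^{|x||y|}\omega(Y,X)$), non-degenerate form with $(-1)^{|z||x|}\omega(X,[Y,Z])+(-1)^{|x||y|}\omega(Y,[Z,X])+(-1)^{|y||z|}\omega(Z,[X,Y])=0$. An even-quadratic odd-symplectic Lie superalgebra $(\mathfrak g,B,\omega)$ carries both; then there is a unique odd invertible superderivation $\delta$ with $\omega(X,Y)=B(\delta(X),Y)$, and it is skew-supersymmetric. A superderivation $\Delta$ of degree $d$ satisfies $\Delta(\mathfrak g_\alpha)\subseteq \mathfrak g_{\alpha+d}$ and $\Delta[X,Y]=[\Delta(X),Y]+(-1)^{d|x|}[X,\Delta(Y)]$; it is skew-supersymmetric for $B$ if $B(\Delta(X),Y)=-(-1)^{d|x|}B(X,\Delta(Y))$.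 Brackets of endomorphisms are supercommutators. Generalized double extension by the two-dimensional abelian Lie superalgebra $\mathbb Ke_0\oplus\mathbb Ke_1$ ($e_0$ even, $e_1$ odd). Let $(\mathfrak h,B,\omega)$ be even-quadratic odd-symplectic with associated odd invertible superderivation $\delta$. Let $D$ (even), $\bar D$ (odd) be skew-supersymmetric superderivations of $(\mathfrak h,B)$, $x_0,c_0\in\mathfrak h_{\bar0}$, $x_1,c_1\in\mathfrak h_{\bar1}$, $k,\alpha\in\mathbb K$, $\lambda\in\mathbb K\setminus\{0\}$ with $\bar D^2=\frac12\mathrm{ad}(x_0)$, $\bar D(x_0)=0$, $B(x_0,x_0)=0$, $[D,\bar D]=\mathrm{ad}(x_1)$, $D(x_0)=2\bar D(x_1)$, and $[\delta,D]-\lambda\bar D=\mathrm{ad}(c_1)$, $[\delta,\bar D]+\lambda D=\mathrm{ad}(c_0)$, $\delta(x_0)=-2\lambda x_1-2\bar D(c_0)$, $\delta(x_1)=\lambda x_0+D(c_0)+\bar D(c_1)$, $\lambda k=B(c_0,x_0)$. On $\mathfrak t=\mathbb Ke_0^*\oplus\mathbb Ke_1^*\oplus\mathfrak h\oplus\mathbb Ke_0\oplus\mathbb Ke_1$ ($e_0^*$ even, $e_1^*$ odd, both central) put $[X,Y]=[X,Y]_{\mathfrak h}-B(\bar D(X),Y)e_1^*+B(D(X),Y)e_0^*$, $[e_0,X]=D(X)+B(x_1,X)e_1^*$, $[e_1,X]=\bar D(X)-B(x_0,X)e_1^*+B(x_1,X)e_0^*$, $[e_1,e_1]=ke_0^*+x_0$,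 $[e_0,e_1]=ke_1^*+x_1$, $[e_0,e_0]=0$; let $\gamma$ be the supersymmetric form with $\gamma|_{\mathfrak h\times\mathfrak h}=B$, $\gamma(e_0^*,e_0)=1=\gamma(e_1^*,e_1)$, other pairings zero (up to supersymmetry); let $\Delta(e_0^* )=\lambda e_1^*$, $\Delta(e_1^* )=\lambda e_0^*$, $\Delta(e_0)=\alpha e_1^*+c_1+\lambda e_1$, $\Delta(e_1)=-\alpha e_0^*+c_0-\lambda e_0$, $\Delta(X)=-B(c_1,X)e_0^*+\delta(X)-B(c_0,X)e_1^*$. Then $(\mathfrak t,\gamma,\Omega)$ with $\Omega(X,Y)=\gamma(\Delta(X),Y)$ is an even-quadratic odd-symplectic Lie superalgebra, called the generalized double extension of $(\mathfrak h,B,\omega)$ by the two-dimensional abelian Lie superalgebra. "Is obtained" is up to isomorphism preserving both forms. *)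

theory Defs
  imports
    "HOL-Library.Z2"
    "HOL-Library.Product_Plus"
    "HOL-Computational_Algebra.Polynomial"
begin

section \<open>Superspaces carried by subspaces of an ambient vector space\<close>

text \<open>
  A superspace is given inside an ambient vector space, the type \<open>'v\<close> with scalar multiplication
  \<open>smult\<close>: only the homogeneous components \<open>grade G 0\<close>, \<open>grade G 1\<close> and their sum matter, and all
  maps and forms are constrained on that sum only. The type \<open>bit\<close> is the field with two elements,
  so degrees are added and multiplied in it.
\<close>

record ('k, 'v) superalgebra =
  smult :: "'k \<Rightarrow> 'v \<Rightarrow> 'v"
  grade :: "bit \<Rightarrow> 'v set"
  bracket :: "'v \<Rightarrow> 'v \<Rightarrow> 'v"

record ('k, 'v) qs_superalgebra = "('k, 'v) superalgebra" +
  qform :: "'v \<Rightarrow> 'v \<Rightarrow> 'k"   \<comment> \<open>the even form, \<open>B\<close> or \<open>\<gamma>\<close>\<close>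
  sform :: "'v \<Rightarrow> 'v \<Rightarrow> 'k"   \<comment> \<open>the odd form, \<open>\<omega>\<close> or \<open>\<Omega>\<close>\<close>

definition carrier :: "('k, 'v::ab_group_add, 'm) superalgebra_scheme \<Rightarrow> 'v set" where
  "carrier G = {x + y | x y. x \<in> grade G 0 \<and> y \<in> grade G 1}"

definition sgn_pow :: "bit \<Rightarrow> 'k::field" where   \<comment> \<open>\<open>(-1)\<close> to the power \<open>d\<close>\<close>
  "sgn_pow d = (if d = 0 then 1 else - 1)"

definition linear_on ::
  "('k \<Rightarrow> 'v \<Rightarrow> 'v) \<Rightarrow> ('k \<Rightarrow> 'w \<Rightarrow> 'w) \<Rightarrow> 'v::ab_group_add set \<Rightarrow> ('v \<Rightarrow> 'w::ab_group_add) \<Rightarrow> bool" where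
  "linear_on s t S f \<longleftrightarrow>
     (\<forall>x\<in>S. \<forall>y\<in>S. f (x + y) = f x + f y) \<and> (\<forall>c. \<forall>x\<in>S. f (s c x) = t c (f x))"

definition bilinear_on ::
  "('k \<Rightarrow> 'v \<Rightarrow> 'v) \<Rightarrow> ('k \<Rightarrow> 'w \<Rightarrow> 'w) \<Rightarrow> 'v::ab_group_add set \<Rightarrow> ('v \<Rightarrow> 'v \<Rightarrow> 'w::ab_group_add) \<Rightarrow> bool" where
  "bilinear_on s t S f \<longleftrightarrow>
     (\<forall>x\<in>S. linear_on s t S (\<lambda>y. f x y)) \<and> (\<forall>y\<in>S. linear_on s t S (\<lambda>x. f x y))"

definition finite_dim_superspace ::
  "('k::field, 'v::ab_group_add, 'm) superalgebra_scheme \<Rightarrow> bool" where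
  "finite_dim_superspace G \<longleftrightarrow>
     vector_space (smult G) \<and>
     (\<forall>a. module.subspace (smult G) (grade G a)) \<and>
     grade G 0 \<inter> grade G 1 = {0} \<and>
     (\<exists>S. finite S \<and> carrier G = module.span (smult G) S)"

text \<open>All Lie superalgebras are finite dimensional.\<close>

definition lie_superalgebra ::
  "('k::field, 'v::ab_group_add, 'm) superalgebra_scheme \<Rightarrow> bool" where
  "lie_superalgebra G \<longleftrightarrow>
     finite_dim_superspace G \<and>
     bilinear_on (smult G) (smult G) (carrier G) (bracket G) \<and>
     (\<forall>a b. \<forall>x\<in>grade G a. \<forall>y\<in>grade G b. bracket G x y \<in> grade G (a + b)) \<and>
     (\<forall>a b. \<forall>x\<in>grade G a. \<forall>y\<in>grade G b.
        bracket G x y = smult G (- sgn_pow (a * b)) (bracket G y x)) \<and>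
     (\<forall>a b c. \<forall>x\<in>grade G a. \<forall>y\<in>grade G b. \<forall>z\<in>grade G c.
        smult G (sgn_pow (c * a)) (bracket G x (bracket G y z)) +
        smult G (sgn_pow (a * b)) (bracket G y (bracket G z x)) +
        smult G (sgn_pow (b * c)) (bracket G z (bracket G x y)) = 0)"


section \<open>Bilinear forms\<close>

definition bilinear_form ::
  "('k::field, 'v::ab_group_add, 'm) superalgebra_scheme \<Rightarrow> ('v \<Rightarrow> 'v \<Rightarrow> 'k) \<Rightarrow> bool" where
  "bilinear_form G \<theta> \<longleftrightarrow> bilinear_on (smult G) (*) (carrier G) \<theta>"

definition even_form ::
  "('k::field, 'v, 'm) superalgebra_scheme \<Rightarrow> ('v \<Rightarrow> 'v \<Rightarrow> 'k) \<Rightarrow> bool" where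
  "even_form G \<theta> \<longleftrightarrow> (\<forall>a b. a \<noteq> b \<longrightarrow> (\<forall>x\<in>grade G a. \<forall>y\<in>grade G b. \<theta> x y = 0))"

definition odd_form ::
  "('k::field, 'v, 'm) superalgebra_scheme \<Rightarrow> ('v \<Rightarrow> 'v \<Rightarrow> 'k) \<Rightarrow> bool" where
  "odd_form G \<theta> \<longleftrightarrow> (\<forall>a. \<forall>x\<in>grade G a. \<forall>y\<in>grade G a. \<theta> x y = 0)"

definition supersymmetric ::
  "('k::field, 'v, 'm) superalgebra_scheme \<Rightarrow> ('v \<Rightarrow> 'v \<Rightarrow> 'k) \<Rightarrow> bool" where
  "supersymmetric G \<theta> \<longleftrightarrow>
     (\<forall>a b. \<forall>x\<in>grade G a. \<forall>y\<in>grade G b. \<theta> x y = sgn_pow (a * b) * \<theta> y x)"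

definition skew_supersymmetric_form ::
  "('k::field, 'v, 'm) superalgebra_scheme \<Rightarrow> ('v \<Rightarrow> 'v \<Rightarrow> 'k) \<Rightarrow> bool" where
  "skew_supersymmetric_form G \<theta> \<longleftrightarrow>
     (\<forall>a b. \<forall>x\<in>grade G a. \<forall>y\<in>grade G b. \<theta> x y = - sgn_pow (a * b) * \<theta> y x)"

definition invariant_form ::
  "('k::field, 'v::ab_group_add, 'm) superalgebra_scheme \<Rightarrow> ('v \<Rightarrow> 'v \<Rightarrow> 'k) \<Rightarrow> bool" where
  "invariant_form G \<theta> \<longleftrightarrow>
     (\<forall>x\<in>carrier G. \<forall>y\<in>carrier G. \<forall>z\<in>carrier G.
        \<theta> (bracket G x y) z = \<theta> x (bracket G y z))"

definition nondegenerate ::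
  "('k::field, 'v::ab_group_add, 'm) superalgebra_scheme \<Rightarrow> ('v \<Rightarrow> 'v \<Rightarrow> 'k) \<Rightarrow> bool" where
  "nondegenerate G \<theta> \<longleftrightarrow>
     (\<forall>x\<in>carrier G. (\<forall>y\<in>carrier G. \<theta> x y = 0) \<longrightarrow> x = 0) \<and>
     (\<forall>y\<in>carrier G. (\<forall>x\<in>carrier G. \<theta> x y = 0) \<longrightarrow> y = 0)"

definition even_invariant_scalar_product ::
  "('k::field, 'v::ab_group_add, 'm) superalgebra_scheme \<Rightarrow> ('v \<Rightarrow> 'v \<Rightarrow> 'k) \<Rightarrow> bool" where
  "even_invariant_scalar_product G \<theta> \<longleftrightarrow>
     bilinear_form G \<theta> \<and> even_form G \<theta> \<and> supersymmetric G \<theta> \<and>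
     invariant_form G \<theta> \<and> nondegenerate G \<theta>"

definition odd_symplectic_form ::
  "('k::field, 'v::ab_group_add, 'm) superalgebra_scheme \<Rightarrow> ('v \<Rightarrow> 'v \<Rightarrow> 'k) \<Rightarrow> bool" where
  "odd_symplectic_form G \<theta> \<longleftrightarrow>
     bilinear_form G \<theta> \<and> odd_form G \<theta> \<and> skew_supersymmetric_form G \<theta> \<and> nondegenerate G \<theta> \<and>
     (\<forall>a b c. \<forall>x\<in>grade G a. \<forall>y\<in>grade G b. \<forall>z\<in>grade G c.
        sgn_pow (c * a) * \<theta> x (bracket G y z) +
        sgn_pow (a * b) * \<theta> y (bracket G z x) +
        sgn_pow (b * c) * \<theta> z (bracket G x y) = 0)"

definition even_quadratic_odd_symplectic ::
  "('k::field, 'v::ab_group_add, 'm) qs_superalgebra_scheme \<Rightarrow> bool" where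
  "even_quadratic_odd_symplectic G \<longleftrightarrow>
     lie_superalgebra G \<and>
     even_invariant_scalar_product G (qform G) \<and>
     odd_symplectic_form G (sform G)"

definition isometric_isomorphism ::
  "('k::field, 'v::ab_group_add, 'm) qs_superalgebra_scheme \<Rightarrow>
   ('k, 'w::ab_group_add, 'n) qs_superalgebra_scheme \<Rightarrow> ('v \<Rightarrow> 'w) \<Rightarrow> bool" where
  "isometric_isomorphism G H f \<longleftrightarrow>
     linear_on (smult G) (smult H) (carrier G) f \<and>
     bij_betw f (carrier G) (carrier H) \<and>
     (\<forall>a. f ` grade G a \<subseteq> grade H a) \<and>
     (\<forall>x\<in>carrier G. \<forall>y\<in>carrier G.
        f (bracket G x y) = bracket H (f x) (f y) \<and>
        qform H (f x) (f y) = qform G x y \<and>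
        sform H (f x) (f y) = sform G x y)"


section \<open>Superderivations\<close>

definition superderivation ::
  "('k::field, 'v::ab_group_add, 'm) superalgebra_scheme \<Rightarrow> bit \<Rightarrow> ('v \<Rightarrow> 'v) \<Rightarrow> bool" where
  "superderivation G d f \<longleftrightarrow>
     linear_on (smult G) (smult G) (carrier G) f \<and>
     (\<forall>a. f ` grade G a \<subseteq> grade G (a + d)) \<and>
     (\<forall>a. \<forall>x\<in>grade G a. \<forall>y\<in>carrier G.
        f (bracket G x y) =
          bracket G (f x) y + smult G (sgn_pow (d * a)) (bracket G x (f y)))"

definition skew_supersymmetric_map ::
  "('k::field, 'v::ab_group_add, 'm) qs_superalgebra_scheme \<Rightarrow> bit \<Rightarrow> ('v \<Rightarrow> 'v) \<Rightarrow> bool" where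
  "skew_supersymmetric_map G d f \<longleftrightarrow>
     (\<forall>a. \<forall>x\<in>grade G a. \<forall>y\<in>carrier G.
        qform G (f x) y = - sgn_pow (d * a) * qform G x (f y))"

definition associated_superderivation ::
  "('k::field, 'v::ab_group_add, 'm) qs_superalgebra_scheme \<Rightarrow> ('v \<Rightarrow> 'v) \<Rightarrow> bool" where
  "associated_superderivation G \<delta> \<longleftrightarrow>
     superderivation G 1 \<delta> \<and> bij_betw \<delta> (carrier G) (carrier G) \<and>
     (\<forall>x\<in>carrier G. \<forall>y\<in>carrier G. sform G x y = qform G (\<delta> x) y)"

text \<open>Supercommutator of maps \<open>f\<close>, \<open>g\<close> of degrees \<open>a\<close>, \<open>b\<close>.\<close>

definition supercommutator ::
  "('k::field, 'v::ab_group_add, 'm) superalgebra_scheme \<Rightarrow>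
   bit \<Rightarrow> bit \<Rightarrow> ('v \<Rightarrow> 'v) \<Rightarrow> ('v \<Rightarrow> 'v) \<Rightarrow> 'v \<Rightarrow> 'v" where
  "supercommutator G a b f g = (\<lambda>x. f (g x) - smult G (sgn_pow (a * b)) (g (f x)))"


section \<open>Generalized double extension by the two-dimensional abelian Lie superalgebra\<close>

definition double_extension_data ::
  "('k::field, 'v::ab_group_add, 'm) qs_superalgebra_scheme \<Rightarrow>
   ('v \<Rightarrow> 'v) \<Rightarrow> ('v \<Rightarrow> 'v) \<Rightarrow> ('v \<Rightarrow> 'v) \<Rightarrow>
   'v \<Rightarrow> 'v \<Rightarrow> 'v \<Rightarrow> 'v \<Rightarrow> 'k \<Rightarrow> 'k \<Rightarrow> bool" where
  "double_extension_data H \<delta> D D' x0 x1 c0 c1 k lam \<longleftrightarrow>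
     even_quadratic_odd_symplectic H \<and>
     associated_superderivation H \<delta> \<and>
     superderivation H 0 D \<and> skew_supersymmetric_map H 0 D \<and>
     superderivation H 1 D' \<and> skew_supersymmetric_map H 1 D' \<and>
     x0 \<in> grade H 0 \<and> c0 \<in> grade H 0 \<and> x1 \<in> grade H 1 \<and> c1 \<in> grade H 1 \<and>
     lam \<noteq> 0 \<and>
     (\<forall>x\<in>carrier H. D' (D' x) = smult H (1 / 2) (bracket H x0 x)) \<and>
     D' x0 = 0 \<and>
     qform H x0 x0 = 0 \<and>
     (\<forall>x\<in>carrier H. supercommutator H 0 1 D D' x = bracket H x1 x) \<and>
     D x0 = smult H 2 (D' x1) \<and>
     (\<forall>x\<in>carrier H. supercommutator H 1 0 \<delta> D x - smult H lam (D' x) = bracket H c1 x) \<and>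
     (\<forall>x\<in>carrier H. supercommutator H 1 1 \<delta> D' x + smult H lam (D x) = bracket H c0 x) \<and>
     \<delta> x0 = - smult H (2 * lam) x1 - smult H 2 (D' c0) \<and>
     \<delta> x1 = smult H lam x0 + D c0 + D' c1 \<and>
     lam * k = qform H c0 x0"

text \<open>The component of degree \<open>a\<close> of an element, and the parity involution \<open>x \<mapsto> (-1)\<^bsup>|x|\<^esup> x\<close>.\<close>

definition component ::
  "('k::field, 'v::ab_group_add, 'm) superalgebra_scheme \<Rightarrow> bit \<Rightarrow> 'v \<Rightarrow> 'v" where
  "component G a x = (THE y. y \<in> grade G a \<and> x - y \<in> grade G (a + 1))"

definition parity_inv ::
  "('k::field, 'v::ab_group_add, 'm) superalgebra_scheme \<Rightarrow> 'v \<Rightarrow> 'v" where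
  "parity_inv G x = component G 0 x - component G 1 x"

text \<open>
  The tuple \<open>(a, b, X, p, q)\<close> stands for the element
  \<open>a e\<^sub>0\<^sup>* + b e\<^sub>1\<^sup>* + X + p e\<^sub>0 + q e\<^sub>1\<close> of the extension.
\<close>

type_synonym ('k, 'v) ext = "'k \<times> 'k \<times> 'v \<times> 'k \<times> 'k"

fun ext_smult :: "('k::field \<Rightarrow> 'v \<Rightarrow> 'v) \<Rightarrow> 'k \<Rightarrow> ('k, 'v) ext \<Rightarrow> ('k, 'v) ext" where
  "ext_smult s c (a, b, X, p, q) = (c * a, c * b, s c X, c * p, c * q)"

definition ext_grade ::
  "('k::field, 'v, 'm) superalgebra_scheme \<Rightarrow> bit \<Rightarrow> ('k, 'v) ext set" where
  "ext_grade H d =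
     (if d = 0 then {(a, 0, X, p, 0) | a X p. X \<in> grade H 0}
      else {(0, b, X, 0, q) | b X q. X \<in> grade H 1})"

text \<open>
  The bracket is the bilinear extension of the brackets of the generators. For \<open>X\<close> in \<open>H\<close>,
  superskewsymmetry gives \<open>[X, e\<^sub>0] = - [e\<^sub>0, X]\<close>, whereas
  \<open>[X, e\<^sub>1] = - (-1)\<^bsup>|X|\<^esup> [e\<^sub>1, X]\<close>; this is where \<open>parity_inv\<close> enters.
\<close>

fun ext_bracket ::
  "('k::field, 'v::ab_group_add, 'm) qs_superalgebra_scheme \<Rightarrow>
   ('v \<Rightarrow> 'v) \<Rightarrow> ('v \<Rightarrow> 'v) \<Rightarrow> 'v \<Rightarrow> 'v \<Rightarrow> 'k \<Rightarrow>
   ('k, 'v) ext \<Rightarrow> ('k, 'v) ext \<Rightarrow> ('k, 'v) ext" where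
  "ext_bracket H D D' x0 x1 k (a, b, X, p, q) (a', b', Y, p', q') =
     (let B = qform H;
          scale = ext_smult (smult H);
          hh = (B (D X) Y, - B (D' X) Y, bracket H X Y, 0, 0);
          e0h = (\<lambda>Z. (0, B x1 Z, D Z, 0, 0));
          e1h = (\<lambda>Z. (B x1 Z, - B x0 Z, D' Z, 0, 0));
          e1e1 = (k, 0, x0, 0, 0);
          e0e1 = (0, k, x1, 0, 0)
      in hh + scale p (e0h Y) + scale q (e1h Y)
            - scale p' (e0h X) - scale q' (e1h (parity_inv H X))
            + scale (q * q') e1e1 + scale (p * q' - q * p') e0e1)"

text \<open>Supersymmetry forces \<open>\<gamma>(e\<^sub>1, e\<^sub>1\<^sup>*) = - \<gamma>(e\<^sub>1\<^sup>*, e\<^sub>1) = - 1\<close>.\<close>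

fun ext_qform ::
  "('k::field, 'v, 'm) qs_superalgebra_scheme \<Rightarrow> ('k, 'v) ext \<Rightarrow> ('k, 'v) ext \<Rightarrow> 'k" where
  "ext_qform H (a, b, X, p, q) (a', b', Y, p', q') =
     qform H X Y + (a * p' + p * a') + (b * q' - q * b')"

fun ext_Delta ::
  "('k::field, 'v::ab_group_add, 'm) qs_superalgebra_scheme \<Rightarrow>
   ('v \<Rightarrow> 'v) \<Rightarrow> 'v \<Rightarrow> 'v \<Rightarrow> 'k \<Rightarrow> 'k \<Rightarrow> ('k, 'v) ext \<Rightarrow> ('k, 'v) ext" where
  "ext_Delta H \<delta> c0 c1 \<alpha> lam (a, b, X, p, q) =
     (let scale = ext_smult (smult H)
      in scale a (0, lam, 0, 0, 0) + scale b (lam, 0, 0, 0, 0)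
         + (- qform H c1 X, - qform H c0 X, \<delta> X, 0, 0)
         + scale p (0, \<alpha>, c1, 0, lam) + scale q (- \<alpha>, 0, c0, - lam, 0))"

definition double_extension ::
  "('k::field, 'v::ab_group_add, 'm) qs_superalgebra_scheme \<Rightarrow>
   ('v \<Rightarrow> 'v) \<Rightarrow> ('v \<Rightarrow> 'v) \<Rightarrow> ('v \<Rightarrow> 'v) \<Rightarrow>
   'v \<Rightarrow> 'v \<Rightarrow> 'v \<Rightarrow> 'v \<Rightarrow> 'k \<Rightarrow> 'k \<Rightarrow> 'k \<Rightarrow> ('k, ('k, 'v) ext) qs_superalgebra" where
  "double_extension H \<delta> D D' x0 x1 c0 c1 k \<alpha> lam =
     \<lparr> smult = ext_smult (smult H),
       grade = ext_grade H,
       bracket = ext_bracket H D D' x0 x1 k,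
       qform = ext_qform H,
       sform = (\<lambda>X Y. ext_qform H (ext_Delta H \<delta> c0 c1 \<alpha> lam X) Y) \<rparr>"

text \<open>
  Superalgebras obtained from \<open>{0}\<close> by finitely many generalized double extensions, each up to
  isomorphism preserving both forms. Every stage is carried by some subspace of the ambient type
  \<open>'v\<close>. This loses no generality: dimensions increase along the sequence, so earlier stages can be
  transported into any ambient space in which the last one lives.
\<close>

inductive obtained_from_zero ::
  "('k::field, 'v::ab_group_add) qs_superalgebra \<Rightarrow> bool" where
  zero: "obtained_from_zero G"
    if "even_quadratic_odd_symplectic G" and "carrier G = {0}"
| extend: "obtained_from_zero G"
    if "obtained_from_zero H"
      and "double_extension_data H \<delta> D D' x0 x1 c0 c1 k lam"
      and "even_quadratic_odd_symplectic G"
      and "isometric_isomorphism (double_extension H \<delta> D D' x0 x1 c0 c1 k \<alpha> lam) G f"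

end

theory Submission
  imports Defs
begin

text \<open>
  Let \<open>\<delta>\<close> be the odd invertible superderivation with \<open>\<omega>(x, y) = B(\<delta> x, y)\<close>. The proof removes from a
  nonzero algebra a central plane together with a dual plane, recognises the algebra as a double
  extension of what is left, and repeats this until nothing is left.

  The central plane exists because the even derivation \<open>\<delta>\<^sup>2\<close> is invertible. Brackets add its
  eigenvalues, and \<open>0\<close> is not an eigenvalue, so in characteristic zero \<open>ad x\<close> is nilpotent for every
  generalized eigenvector \<open>x\<close>: repeated application runs out of the finite spectrum. The operators
  \<open>ad x\<close>, for \<open>x\<close> a generalized eigenvector homogeneous for the parity, form a set that is closed
  under brackets up to signs and scalars, and a theorem of Jacobson in the style of Engel
  (\<open>weakly_closed_nil\<close>) yields a common null vector of all of them. Since these \<open>x\<close> span the algebra,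
  the center is nonzero. It is graded and stable under \<open>\<delta>\<close>, and \<open>\<delta>\<close> exchanges its two homogeneous
  components; so it contains an even eigenvector \<open>f\<^sub>0\<close> of \<open>\<delta>\<^sup>2\<close>, with eigenvalue \<open>\<lambda>\<^sup>2 \<noteq> 0\<close>
  (\<open>central_eigenvector\<close>). With \<open>f\<^sub>1 = \<lambda>\<^sup>-\<^sup>1 \<delta> f\<^sub>0\<close>, the plane spanned by \<open>f\<^sub>0\<close> and \<open>f\<^sub>1\<close> is a central
  ideal stable under \<open>\<delta>\<close>. It is isotropic, because odd vectors are and \<open>\<delta>\<close> is skew
  for \<open>B\<close>.

  Choose \<open>e\<^sub>0\<close> even isotropic and \<open>e\<^sub>1\<close> odd, dual to \<open>f\<^sub>0\<close> and \<open>f\<^sub>1\<close>. The orthogonal complement \<open>h\<close> of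
  these four vectors, with the bracket and \<open>\<delta>\<close> projected to it, represents the subquotient of the plane's
  orthogonal by the plane, so it is again even-quadratic and odd-symplectic (\<open>eqos_H\<close>). The parts
  of \<open>ad e\<^sub>0\<close>, \<open>ad e\<^sub>1\<close>, of the brackets of the \<open>e\<^sub>i\<close> and of \<open>\<delta> e\<^sub>i\<close> that lie in \<open>h\<close> are the data of
  the extension. Their compatibility conditions are the \<open>h\<close>-components of Jacobi identities and of
  the derivation rule for \<open>\<delta>\<close> (\<open>data_H\<close>). The components along \<open>f\<^sub>0\<close> and \<open>f\<^sub>1\<close> are pairings with \<open>e\<^sub>0\<close>
  and \<open>e\<^sub>1\<close>, which invariance of \<open>B\<close> turns into the formulas in the definition of the double
  extension (\<open>frame_map_isometric\<close>).
\<close>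

section \<open>Linear algebra on finitely spanned subspaces\<close>

context vector_space
begin

lemma linear_onD:
  assumes "linear_on scale t V f"
  shows "x \<in> V \<Longrightarrow> y \<in> V \<Longrightarrow> f (x + y) = f x + f y" "x \<in> V \<Longrightarrow> f (scale c x) = t c (f x)"
  using assms by (auto simp: linear_on_def)

lemma linear_on_0:
  assumes "linear_on scale t V f" "subspace V"
  shows "f 0 = 0"
  using linear_onD(1)[OF assms(1), of 0 0] subspace_0[OF assms(2)] by auto

lemma linear_on_neg:
  assumes "linear_on scale t V f" "subspace V" "x \<in> V"
  shows "f (- x) = - f x"
  using linear_onD(1)[OF assms(1,3), of "- x"] linear_on_0[OF assms(1,2)] subspace_neg[OF assms(2,3)] assms(3)
  by (metis add.right_inverse add_eq_0_iff)

lemma linear_on_diff: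
  assumes "linear_on scale t V f" "subspace V" "x \<in> V" "y \<in> V"
  shows "f (x - y) = f x - f y"
  using linear_onD(1)[OF assms(1,3), of "- y"] linear_on_neg[OF assms(1,2,4)] subspace_neg[OF assms(2,4)]
  by simp

lemma linear_on_eq_on_span:
  assumes "linear_on scale t V f" "linear_on scale t V g" "subspace V"
    and "B \<subseteq> V" "\<And>b. b \<in> B \<Longrightarrow> f b = g b" "x \<in> span B"
  shows "f x = g x"
proof -
  have "subspace {x \<in> V. f x = g x}"
    using assms(1-3) linear_on_0[OF assms(1,3)] linear_on_0[OF assms(2,3)]
    by (intro subspaceI) (auto simp: linear_onD subspace_0 subspace_add subspace_scale)
  then have "span B \<subseteq> {x \<in> V. f x = g x}"
    using assms(4,5) by (intro span_minimal) auto
  then show ?thesis using assms(6) by auto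
qed

lemma finite_basis_exists:
  assumes "finite A" "S \<subseteq> span A"
  obtains B where "finite B" "B \<subseteq> S" "independent B" "S \<subseteq> span B" "card B = dim S"
proof -
  obtain B where B: "B \<subseteq> S" "independent B" "S \<subseteq> span B" "card B = dim S"
    using basis_exists by blast
  then have "finite B" using independent_span_bound[OF assms(1) B(2)] assms(2) by auto
  then show thesis using B that by blast
qed

lemma dim_strict_mono:
  assumes "finite A" "T \<subseteq> span A" "subspace S" "S \<subset> T"
  shows "dim S < dim T"
proof -
  obtain B where B: "finite B" "B \<subseteq> S" "independent B" "S \<subseteq> span B" "card B = dim S"
    using finite_basis_exists[OF assms(1), of S] assms by auto
  obtain x where x: "x \<in> T" "x \<notin> S" using assms(4) by auto
  have "span B = S" using B assms(3) by (simp add: span_subspace)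
  then have "independent (insert x B)" using x B independent_insertI by auto
  moreover have "insert x B \<subseteq> T" using x B assms(4) by auto
  ultimately obtain C where C: "insert x B \<subseteq> C" "C \<subseteq> T" "independent C" "T \<subseteq> span C"
    using maximal_independent_subset_extend by metis
  have "finite C" using independent_span_bound[OF assms(1) C(3)] C(2) assms(2) by auto
  then have "card (insert x B) \<le> card C" using C(1) by (simp add: card_mono)
  also have "card C = dim T" using C basis_card_eq_dim by auto
  finally show ?thesis using B x by (auto simp: card_insert_if split: if_splits)
qed

lemma finite_spanning_subspace:
  assumes "finite A" "S \<subseteq> span A" "subspace S"
  shows "\<exists>B. finite B \<and> S = span B"
  using finite_basis_exists[OF assms(1,2)] assms(3) by (metis span_subspace)

text \<open>The ambient space need not be finite dimensional, and \<open>T\<close> is constrained on \<open>V\<close> only, so \<open>T\<close> is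
  first replaced by a globally linear map that agrees with it on \<open>V\<close>; the image of a basis of \<open>V\<close>
  then has too many independent elements to span a proper subspace.\<close>

lemma injective_endomorphism_surjective:
  assumes "finite A" "V \<subseteq> span A" "subspace V"
    and T: "linear_on scale scale V T" "T ` V \<subseteq> V"
    and inj: "\<And>x. x \<in> V \<Longrightarrow> T x = 0 \<Longrightarrow> x = 0"
  shows "T ` V = V"
proof -
  interpret vector_space_pair scale scale ..
  obtain B where B: "finite B" "B \<subseteq> V" "independent B" "V \<subseteq> span B" "card B = dim V"
    using finite_basis_exists[OF assms(1,2)] by auto
  have V: "V = span B" using B assms(3) by (simp add: span_subspace)
  obtain g where g: "Vector_Spaces.linear scale scale g" "\<forall>x\<in>B. g x = T x"
    using linear_independent_extend[OF B(3)] by blast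
  interpret g: Vector_Spaces.linear scale scale g by fact
  have gl: "linear_on scale scale V g" by (auto simp: linear_on_def g.add g.scale)
  have eq: "g x = T x" if "x \<in> V" for x
    using linear_on_eq_on_span[OF gl T(1) assms(3) B(2)] g(2) that V by auto
  have "inj_on g (span B)"
    unfolding g.inj_on_iff_eq_0[OF subspace_span] using eq inj V by auto
  then have ind: "independent (g ` B)" using g.independent_injective_image[OF B(3)] by auto
  have "inj_on g B" using \<open>inj_on g (span B)\<close> span_superset inj_on_subset by blast
  then have "card (g ` B) = dim V" using B(5) by (simp add: card_image)
  then have "dim (span (g ` B)) = dim V" using dim_span_eq_card_independent[OF ind] by simp
  moreover have "g ` B \<subseteq> V" using eq B(2) T(2) by auto
  then have "span (g ` B) \<subseteq> V" using assms(3) by (rule span_minimal)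
  ultimately have "span (g ` B) = V"
    using dim_strict_mono[OF assms(1,2) subspace_span, of "g ` B"] by (metis less_irrefl psubsetI)
  moreover have "span (g ` B) = g ` V" using g.span_image V by simp
  ultimately show ?thesis using eq by auto
qed

text \<open>In coordinates of a basis \<open>b\<close> of \<open>V\<close>, the map \<open>x \<mapsto> \<Sum> \<beta>(x, b) b\<close> is an endomorphism of \<open>V\<close> that
  is injective by nondegeneracy, hence surjective; a preimage of \<open>\<Sum> \<phi>(b) b\<close> represents \<open>\<phi>\<close>.\<close>

lemma nondegenerate_represents:
  assumes "finite A" "V \<subseteq> span A" "subspace V"
    and \<beta>: "bilinear_on scale (*) V \<beta>" "\<And>x. x \<in> V \<Longrightarrow> (\<forall>y\<in>V. \<beta> x y = 0) \<Longrightarrow> x = 0"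
    and \<phi>: "linear_on scale (*) V \<phi>"
  shows "\<exists>x\<in>V. \<forall>y\<in>V. \<beta> x y = \<phi> y"
proof -
  obtain B where B: "finite B" "B \<subseteq> V" "independent B" "V \<subseteq> span B"
    using finite_basis_exists[OF assms(1,2)] by metis
  define T where "T x = (\<Sum>b\<in>B. scale (\<beta> x b) b)" for x
  have lin1: "linear_on scale (*) V (\<beta> x)" if "x \<in> V" for x
    using \<beta>(1) that by (auto simp: bilinear_on_def)
  have lin2: "linear_on scale (*) V (\<lambda>x. \<beta> x y)" if "y \<in> V" for y
    using \<beta>(1) that by (auto simp: bilinear_on_def)
  have coords: "\<forall>b\<in>B. f b = h b" if "(\<Sum>b\<in>B. scale (f b) b) = (\<Sum>b\<in>B. scale (h b) b)" for f h
  proof -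
    have "(\<Sum>b\<in>B. scale (f b - h b) b) = 0"
      using that by (simp add: scale_left_diff_distrib sum_subtractf)
    then show ?thesis using independentD[OF B(3,1) order_refl, of "\<lambda>b. f b - h b"] by auto
  qed
  have "T ` V = V"
  proof (rule injective_endomorphism_surjective[OF assms(1-3)])
    show "linear_on scale scale V T"
      using B(2) by (auto simp: linear_on_def T_def linear_onD[OF lin2] subset_iff scale_left_distrib
          sum.distrib scale_sum_right intro!: sum.cong simp flip: sum.distrib)
    show "T ` V \<subseteq> V"
      using B(2) assms(3) by (auto simp: T_def intro!: subspace_sum subspace_scale)
    fix x assume x: "x \<in> V" "T x = 0"
    then have "\<forall>b\<in>B. \<beta> x b = 0" using coords[of "\<beta> x" "\<lambda>_. 0"] by (simp add: T_def)
    moreover have "linear_on scale (*) V (\<lambda>_. 0)" by (simp add: linear_on_def)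
    ultimately have "\<forall>y\<in>V. \<beta> x y = 0"
      using linear_on_eq_on_span[OF lin1[OF x(1)] _ assms(3) B(2), of "\<lambda>_. 0"] B(4) by blast
    then show "x = 0" using \<beta>(2) x by blast
  qed
  moreover have "(\<Sum>b\<in>B. scale (\<phi> b) b) \<in> V"
    using B(2) assms(3) by (auto intro!: subspace_sum subspace_scale)
  ultimately obtain x where x: "x \<in> V" "T x = (\<Sum>b\<in>B. scale (\<phi> b) b)" by (metis imageE)
  then have "\<forall>b\<in>B. \<beta> x b = \<phi> b" using coords[of "\<beta> x" \<phi>] by (simp add: T_def)
  then have "\<forall>y\<in>V. \<beta> x y = \<phi> y"
    using linear_on_eq_on_span[OF lin1[OF x(1)] \<phi> assms(3) B(2)] B(4) by blast
  then show ?thesis using x by blast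
qed

end

section \<open>Weakly closed sets of nilpotent operators\<close>

abbreviation apply_word :: "('b \<Rightarrow> 'b) list \<Rightarrow> 'b \<Rightarrow> 'b" where
  "apply_word ws v \<equiv> foldr (\<lambda>w. w) ws v"

lemma funpow_stable: "f ` V \<subseteq> V \<Longrightarrow> v \<in> V \<Longrightarrow> (f ^^ n) v \<in> V"
  by (induction n) auto

text \<open>Jacobson's weakly closed sets: the scalar \<open>\<gamma>\<close> may depend on the pair, which covers commutators and
  anticommutators at once, so that signs of superbrackets need no separate treatment.\<close>

definition weakly_closed ::
  "('k \<Rightarrow> 'v \<Rightarrow> 'v) \<Rightarrow> 'v::ab_group_add set \<Rightarrow> ('v \<Rightarrow> 'v) set \<Rightarrow> bool" where
  "weakly_closed scale V W \<longleftrightarrow>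
     (\<forall>a\<in>W. linear_on scale scale V a \<and> a ` V \<subseteq> V) \<and>
     (\<forall>a\<in>W. \<forall>b\<in>W. \<exists>c\<in>W. \<exists>\<gamma>. \<forall>v\<in>V. c v = a (b v) + scale \<gamma> (b (a v)))"

text \<open>Stated relative to a pair \<open>U \<subseteq> T\<close> of subspaces, this expresses that long products act as zero on the
  quotient \<open>T / U\<close>, while all operators keep acting on the same space.\<close>

definition nil_between :: "'v set \<Rightarrow> 'v set \<Rightarrow> ('v \<Rightarrow> 'v) set \<Rightarrow> bool" where
  "nil_between U T W \<longleftrightarrow> (\<exists>n. \<forall>ws\<in>lists W. length ws = n \<longrightarrow> apply_word ws ` T \<subseteq> U)"

text \<open>The scalar multiples of positive powers of \<open>w\<close> stand in for the weakly closed set generated by \<open>w\<close>.\<close>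

definition power_multiples ::
  "('k \<Rightarrow> 'v \<Rightarrow> 'v) \<Rightarrow> 'v set \<Rightarrow> ('v \<Rightarrow> 'v) \<Rightarrow> ('v \<Rightarrow> 'v) set" where
  "power_multiples scale V w = {a. \<exists>c k. 0 < k \<and> (\<forall>v\<in>V. a v = scale c ((w ^^ k) v))}"

lemma apply_word_stable:
  assumes "\<And>w. w \<in> W \<Longrightarrow> w ` T \<subseteq> T" "ws \<in> lists W"
  shows "apply_word ws ` T \<subseteq> T"
  using assms(2)
proof (induction ws)
  case (Cons a ws)
  then have "foldr (\<lambda>w. w) ws ` T \<subseteq> T" "a ` T \<subseteq> T" using assms(1) by auto
  then show ?case by (auto simp: image_subset_iff)
qed auto

lemma apply_word_long:
  assumes n: "\<And>ws. ws \<in> lists W \<Longrightarrow> length ws = n \<Longrightarrow> apply_word ws ` T \<subseteq> U"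
    and T: "\<And>w. w \<in> W \<Longrightarrow> w ` T \<subseteq> T"
    and ws: "ws \<in> lists W" "n \<le> length ws"
  shows "apply_word ws ` T \<subseteq> U"
proof -
  have "apply_word (drop n ws) ` T \<subseteq> T"
    using T ws(1) by (intro apply_word_stable[of W]) (auto dest: in_set_dropD)
  moreover have "apply_word (take n ws) ` T \<subseteq> U"
    using ws by (intro n) (auto dest: in_set_takeD)
  moreover have "apply_word ws v = apply_word (take n ws) (apply_word (drop n ws) v)" for v
    by (metis append_take_drop_id foldr_append comp_apply)
  ultimately show ?thesis by (auto simp: image_subset_iff)
qed

lemma nil_between_antimono:
  assumes "nil_between U T W" "S \<subseteq> W"
  shows "nil_between U T S"
proof -
  obtain n where n: "\<forall>ws\<in>lists W. length ws = n \<longrightarrow> apply_word ws ` T \<subseteq> U"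
    using assms(1) unfolding nil_between_def by (elim exE)
  have "apply_word ws ` T \<subseteq> U" if "ws \<in> lists S" "length ws = n" for ws
    using n that lists_mono[OF assms(2)] by (metis subsetD)
  then show ?thesis unfolding nil_between_def by (intro exI[of _ n]) simp
qed

lemma nil_between_trans:
  assumes "nil_between U N W" "nil_between N T W"
  shows "nil_between U T W"
proof -
  obtain m n where m: "\<And>ws. ws \<in> lists W \<Longrightarrow> length ws = m \<Longrightarrow> apply_word ws ` N \<subseteq> U"
    and n: "\<And>ws. ws \<in> lists W \<Longrightarrow> length ws = n \<Longrightarrow> apply_word ws ` T \<subseteq> N"
    using assms unfolding nil_between_def by meson
  have "apply_word ws ` T \<subseteq> U" if "ws \<in> lists W" "length ws = m + n" for ws
  proof -
    have "apply_word (take m ws) ` N \<subseteq> U" "apply_word (drop m ws) ` T \<subseteq> N"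
      using that m[of "take m ws"] n[of "drop m ws"] by (auto dest: in_set_takeD in_set_dropD)
    moreover have "apply_word ws v = apply_word (take m ws) (apply_word (drop m ws) v)" for v
      by (metis append_take_drop_id foldr_append comp_apply)
    ultimately show ?thesis by (auto simp: image_subset_iff)
  qed
  then show ?thesis unfolding nil_between_def by blast
qed

text \<open>A longest product that does not vanish modulo \<open>U\<close> has a value that every operator sends into \<open>U\<close>.\<close>

lemma nil_between_common_null_vector:
  assumes "nil_between U T W" "\<not> T \<subseteq> U" "\<And>w. w \<in> W \<Longrightarrow> w ` T \<subseteq> T"
  obtains v where "v \<in> T" "v \<notin> U" "\<And>w. w \<in> W \<Longrightarrow> w v \<in> U"
proof -
  define P where "P n \<longleftrightarrow> (\<forall>ws\<in>lists W. length ws = n \<longrightarrow> apply_word ws ` T \<subseteq> U)" for n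
  have ex: "\<exists>n. P n" using assms(1) by (simp add: nil_between_def P_def)
  define n where "n = (LEAST n. P n)"
  have n: "P n" "\<And>m. m < n \<Longrightarrow> \<not> P m"
    unfolding n_def using LeastI_ex[OF ex] not_less_Least by auto
  have "n \<noteq> 0" using n(1) assms(2) by (auto simp: P_def)
  then obtain m where m: "n = Suc m" by (cases n) auto
  then obtain ws t where ws: "ws \<in> lists W" "length ws = m" "t \<in> T" "apply_word ws t \<notin> U"
    using n(2)[of m] by (auto simp: P_def)
  show thesis
  proof (rule that)
    show "apply_word ws t \<in> T" using apply_word_stable[of W T ws] assms(3) ws by auto
    show "apply_word ws t \<notin> U" by fact
    fix w assume "w \<in> W"
    then have "w # ws \<in> lists W" using ws by auto
    then have "apply_word (w # ws) ` T \<subseteq> U" using n(1) ws(2) m unfolding P_def by (metis length_Cons)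
    then show "w (apply_word ws t) \<in> U" using ws(3) by auto
  qed
qed

context vector_space
begin

lemma weakly_closed_obtain:
  assumes "weakly_closed scale V W" "a \<in> W" "b \<in> W"
  obtains c \<gamma> where "c \<in> W" "\<forall>v\<in>V. c v = a (b v) + scale \<gamma> (b (a v))"
proof -
  have "\<exists>c\<in>W. \<exists>\<gamma>. \<forall>v\<in>V. c v = a (b v) + scale \<gamma> (b (a v))"
    using assms(1)[unfolded weakly_closed_def, THEN conjunct2] assms(2,3) by (elim ballE) auto
  then show thesis using that by (elim bexE exE)
qed

lemma weakly_closed_stabilizer:
  assumes "weakly_closed scale V W" "subspace N" "N \<subseteq> V"
  shows "weakly_closed scale V {w \<in> W. w ` N \<subseteq> N}"
  unfolding weakly_closed_def
proof (intro conjI ballI)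
  fix a b assume "a \<in> {w \<in> W. w ` N \<subseteq> N}" "b \<in> {w \<in> W. w ` N \<subseteq> N}"
  then have ab: "a \<in> W" "b \<in> W" "\<And>v. v \<in> N \<Longrightarrow> a v \<in> N" "\<And>v. v \<in> N \<Longrightarrow> b v \<in> N" by auto
  obtain c \<gamma> where c: "c \<in> W" "\<forall>v\<in>V. c v = a (b v) + scale \<gamma> (b (a v))"
    using weakly_closed_obtain[OF assms(1) ab(1,2)] by metis
  have "c ` N \<subseteq> N"
    using c(2) ab assms(2,3) by (auto simp: subset_iff subspace_add subspace_scale)
  then show "\<exists>c\<in>{w \<in> W. w ` N \<subseteq> N}. \<exists>\<gamma>. \<forall>v\<in>V. c v = a (b v) + scale \<gamma> (b (a v))"
    using c by auto
qed (use assms(1) in \<open>auto simp: weakly_closed_def\<close>)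

lemma linear_on_funpow:
  assumes "linear_on scale scale V f" "f ` V \<subseteq> V"
  shows "linear_on scale scale V (f ^^ n)"
proof (induction n)
  case (Suc n)
  then show ?case
    using assms(1) funpow_stable[OF assms(2)] unfolding linear_on_def by simp
qed (simp add: linear_on_def)

lemma weakly_closed_power_multiples:
  assumes W: "weakly_closed scale V W" "w \<in> W" and V: "subspace V"
  shows "weakly_closed scale V (W \<inter> power_multiples scale V w)"
  unfolding weakly_closed_def
proof (intro conjI ballI)
  have w: "linear_on scale scale V w" "w ` V \<subseteq> V" using W by (auto simp: weakly_closed_def)
  fix a b assume "a \<in> W \<inter> power_multiples scale V w" "b \<in> W \<inter> power_multiples scale V w"
  then obtain c k d l where a: "a \<in> W" "0 < k" "\<forall>v\<in>V. a v = scale c ((w ^^ k) v)"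
    and b: "b \<in> W" "0 < l" "\<forall>v\<in>V. b v = scale d ((w ^^ l) v)"
    by (auto simp: power_multiples_def)
  obtain e \<gamma> where e: "e \<in> W" "\<forall>v\<in>V. e v = a (b v) + scale \<gamma> (b (a v))"
    using weakly_closed_obtain[OF W(1) a(1) b(1)] by metis
  have "e v = scale (c * d + \<gamma> * (d * c)) ((w ^^ (k + l)) v)" if "v \<in> V" for v
  proof -
    have st: "(w ^^ n) v \<in> V" for n using funpow_stable[OF w(2) that] .
    have "a (b v) = scale (c * d) ((w ^^ (k + l)) v)"
      using a(3) b(3) that st V linear_onD(2)[OF linear_on_funpow[OF w]]
      by (simp add: subspace_scale funpow_add)
    moreover have "b (a v) = scale (d * c) ((w ^^ (l + k)) v)"
      using a(3) b(3) that st V linear_onD(2)[OF linear_on_funpow[OF w]]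
      by (simp add: subspace_scale funpow_add)
    ultimately show ?thesis using e(2) that by (simp add: add.commute[of l k] scale_left_distrib)
  qed
  then have "\<forall>v\<in>V. e v = scale (c * d + \<gamma> * (d * c)) ((w ^^ (k + l)) v)" by blast
  then have "e \<in> power_multiples scale V w"
    unfolding power_multiples_def mem_Collect_eq using a(2)
    by (intro exI[of _ "c * d + \<gamma> * (d * c)"] exI[of _ "k + l"] conjI) auto
  then show "\<exists>c\<in>W \<inter> power_multiples scale V w. \<exists>\<gamma>. \<forall>v\<in>V. c v = a (b v) + scale \<gamma> (b (a v))"
    using e by blast
qed (use W(1) in \<open>auto simp: weakly_closed_def\<close>)

lemma nil_power_multiples:
  assumes w: "linear_on scale scale V w" "w ` V \<subseteq> V" and V: "subspace V"
    and nil: "\<forall>v\<in>V. (w ^^ n) v = 0" and U: "subspace U" "T \<subseteq> V"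
  shows "nil_between U T (power_multiples scale V w)"
proof -
  have word: "\<exists>c k. length ws \<le> k \<and> (\<forall>v\<in>V. apply_word ws v = scale c ((w ^^ k) v))"
    if "ws \<in> lists (power_multiples scale V w)" for ws
    using that
  proof (induction ws)
    case Nil
    show ?case by (rule exI[of _ 1], rule exI[of _ 0]) simp
  next
    case (Cons a ws)
    then obtain c k where ck: "length ws \<le> k" "\<forall>v\<in>V. apply_word ws v = scale c ((w ^^ k) v)" by auto
    from Cons obtain d l where dl: "0 < l" "\<forall>v\<in>V. a v = scale d ((w ^^ l) v)"
      by (auto simp: power_multiples_def)
    have "\<forall>v\<in>V. apply_word (a # ws) v = scale (d * c) ((w ^^ (l + k)) v)"
      using ck dl V funpow_stable[OF w(2)] linear_onD(2)[OF linear_on_funpow[OF w]]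
      by (simp add: subspace_scale funpow_add)
    moreover have "length (a # ws) \<le> l + k" using ck dl by auto
    ultimately show ?case by blast
  qed
  have "apply_word ws ` T \<subseteq> U" if ws: "ws \<in> lists (power_multiples scale V w)" "length ws = n" for ws
  proof -
    obtain c k where ck: "n \<le> k" "\<forall>v\<in>V. apply_word ws v = scale c ((w ^^ k) v)"
      using word[OF ws(1)] ws(2) by blast
    have "(w ^^ k) v = 0" if "v \<in> V" for v
      using nil ck(1) funpow_stable[OF w(2) that] funpow_add[of n "k - n" w] by simp
    then show ?thesis using ck U subspace_0[OF U(1)] by auto
  qed
  then show ?thesis unfolding nil_between_def by blast
qed

text \<open>Jacobson's theorem, by induction on \<open>dim T - dim U\<close>. For a subset \<open>S\<close> of \<open>W\<close> that is weakly closed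
  and nil between \<open>U\<close> and \<open>T\<close>, let \<open>N S\<close> be the preimage in \<open>T\<close> of the common kernel of \<open>S\<close> on
  \<open>T / U\<close>, and choose \<open>S\<close> so that \<open>N S\<close> has least dimension. If \<open>N S = T\<close>, then by
  minimality the powers of any single element of \<open>W\<close> give all of \<open>T\<close> too, so \<open>W\<close> maps \<open>T\<close> into \<open>U\<close>. Otherwise
  \<open>N S\<close> lies strictly between \<open>U\<close> and \<open>T\<close>, and the induction hypothesis on both steps makes the
  stabilizer \<open>C\<close> of \<open>N S\<close> nil. Minimality gives \<open>N C = N S\<close>; hence an element that \<open>S\<close> brackets
  into \<open>C\<close> stabilizes \<open>N S\<close> and lies in \<open>C\<close>. An element outside \<open>C\<close> could
  therefore be bracketed with \<open>S\<close> forever without entering \<open>C\<close>, although the resulting operators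
  eventually map \<open>T\<close> into \<open>U\<close>. So \<open>C = W\<close>.\<close>

theorem weakly_closed_nil:
  assumes fin: "finite A" "V \<subseteq> span A" "subspace V"
    and W: "weakly_closed scale V W" "\<And>w. w \<in> W \<Longrightarrow> \<exists>n. \<forall>v\<in>V. (w ^^ n) v = 0"
    and U: "subspace U" "U \<subseteq> T" "\<And>w. w \<in> W \<Longrightarrow> w ` U \<subseteq> U"
    and T: "subspace T" "T \<subseteq> V" "\<And>w. w \<in> W \<Longrightarrow> w ` T \<subseteq> T"
  shows "nil_between U T W"
  using W U T
proof (induction "dim T - dim U" arbitrary: U T W rule: less_induct)
  case less
  note W = less.prems(1,2) and U = less.prems(3,4,5) and T = less.prems(6,7,8)
  have lin: "linear_on scale scale V w" "w ` V \<subseteq> V" if "w \<in> W" for w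
    using W(1) that by (auto simp: weakly_closed_def)
  show ?case
  proof (cases "T \<subseteq> U")
    case True
    then show ?thesis unfolding nil_between_def by (intro exI[of _ 0]) auto
  next
    case False
    define N where "N S = {t \<in> T. \<forall>s\<in>S. s t \<in> U}" for S :: "('b \<Rightarrow> 'b) set"
    define \<Omega> where "\<Omega> S \<longleftrightarrow> S \<subseteq> W \<and> weakly_closed scale V S \<and> nil_between U T S" for S
    have N_sub: "subspace (N S)" if "S \<subseteq> W" for S
    proof (rule subspaceI)
      have S: "linear_on scale scale V s" if "s \<in> S" for s using lin(1) that \<open>S \<subseteq> W\<close> by blast
      show "0 \<in> N S"
      proof -
        have "s 0 \<in> U" if "s \<in> S" for s
          unfolding linear_on_0[OF S[OF that] fin(3)] using subspace_0[OF U(1)] .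
        then show ?thesis using subspace_0[OF T(1)] by (simp add: N_def)
      qed
      fix x y c assume "x \<in> N S" "y \<in> N S"
      then have xy: "x \<in> T" "y \<in> T" "\<And>s. s \<in> S \<Longrightarrow> s x \<in> U" "\<And>s. s \<in> S \<Longrightarrow> s y \<in> U"
        by (auto simp: N_def)
      have xyV: "x \<in> V" "y \<in> V" using xy T(2) by auto
      have "s (x + y) \<in> U" if "s \<in> S" for s
        unfolding linear_onD(1)[OF S[OF that] xyV] using xy that U(1) by (simp add: subspace_add)
      then show "x + y \<in> N S" using xy T(1) by (simp add: N_def subspace_add)
      have "s (scale c x) \<in> U" if "s \<in> S" for s
        unfolding linear_onD(2)[OF S[OF that] xyV(1)] using xy that U(1) by (simp add: subspace_scale)
      then show "scale c x \<in> N S" using xy T(1) by (simp add: N_def subspace_scale)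
    qed
    have "\<Omega> {}" by (auto simp: \<Omega>_def weakly_closed_def nil_between_def intro: exI[of _ 1])
    then obtain S where S: "\<Omega> S" "\<And>S'. \<Omega> S' \<Longrightarrow> dim (N S) \<le> dim (N S')"
      using ex_has_least_nat[of \<Omega> "{}" "\<lambda>S. dim (N S)"] by blast
    have SW: "S \<subseteq> W" using S(1) by (simp add: \<Omega>_def)
    have NT: "N S \<subseteq> T" by (auto simp: N_def)
    have TA: "T \<subseteq> span A" using T(2) fin(2) by auto
    have UN: "U \<subseteq> N S" using U SW by (auto simp: N_def)
    have "nil_between U T S" "\<And>w. w \<in> S \<Longrightarrow> w ` T \<subseteq> T" using S(1) T(3) SW by (auto simp: \<Omega>_def)
    then obtain v where "v \<in> T" "v \<notin> U" "\<And>s. s \<in> S \<Longrightarrow> s v \<in> U"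
      using nil_between_common_null_vector[of U T S] False by metis
    then have "v \<in> N S - U" by (auto simp: N_def)
    then have dUN: "dim U < dim (N S)"
      using dim_strict_mono[OF fin(1), of "N S" U] NT TA U(1) UN by auto
    show ?thesis
    proof (cases "N S = T")
      case True
      have "w ` T \<subseteq> U" if w: "w \<in> W" for w
      proof -
        obtain n where n: "\<forall>v\<in>V. (w ^^ n) v = 0" using W(2)[OF w] by blast
        let ?X = "W \<inter> power_multiples scale V w"
        have "nil_between U T ?X"
          using nil_power_multiples[OF lin[OF w] fin(3) n U(1) T(2)] by (rule nil_between_antimono) auto
        then have "\<Omega> ?X" using weakly_closed_power_multiples[OF W(1) w fin(3)] by (simp add: \<Omega>_def)
        then have "dim (N ?X) \<ge> dim T" using S(2) True by auto
        then have "N ?X = T"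
          using dim_strict_mono[OF fin(1) TA N_sub[of ?X]] by (force simp: N_def)
        moreover have "w \<in> ?X" using w by (auto simp: power_multiples_def intro!: exI[of _ 1])
        ultimately show ?thesis by (auto simp: N_def)
      qed
      then have "w t \<in> U" if "w \<in> W" "t \<in> T" for w t using that by blast
      then show ?thesis
        unfolding nil_between_def by (intro exI[of _ 1]) (auto simp: length_Suc_conv)
    next
      case False
      then have "N S \<subset> T" using NT by blast
      then have dNT: "dim (N S) < dim T" by (rule dim_strict_mono[OF fin(1) TA N_sub[OF SW]])
      define C where "C = {w \<in> W. w ` N S \<subseteq> N S}"
      have CW: "C \<subseteq> W" by (auto simp: C_def)
      have wcC: "weakly_closed scale V C"
        unfolding C_def using NT T(2) by (intro weakly_closed_stabilizer W N_sub SW) auto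
      have SC: "S \<subseteq> C" using SW UN by (force simp: C_def N_def)
      have nil1: "nil_between U (N S) C"
      proof (rule less.hyps)
        show "dim (N S) - dim U < dim T - dim U" using dNT dUN by auto
      qed (use wcC W(2) U UN NT T(2) N_sub[OF SW] in \<open>auto simp: C_def\<close>)
      have nil2: "nil_between (N S) T C"
      proof (rule less.hyps)
        show "dim T - dim (N S) < dim T - dim U" using dNT dUN by auto
      qed (use wcC W(2) T NT N_sub[OF SW] in \<open>auto simp: C_def\<close>)
      have "\<Omega> C" using nil_between_trans[OF nil1 nil2] wcC CW by (simp add: \<Omega>_def)
      then have "dim (N S) \<le> dim (N C)" by (rule S(2))
      moreover have "N C \<subseteq> N S" using SC by (auto simp: N_def)
      moreover have "N S \<subseteq> span A" using NT TA by auto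
      ultimately have NC: "N C = N S"
        using dim_strict_mono[OF fin(1) _ N_sub[OF CW], of "N S"] by (metis leD psubsetI)
      have norm: "\<exists>s\<in>S. \<exists>\<gamma>. \<exists>c\<in>W - C. \<forall>v\<in>V. c v = s (w v) + scale \<gamma> (w (s v))"
        if w: "w \<in> W - C" for w
      proof (rule ccontr)
        assume neg: "\<not> ?thesis"
        have "w v \<in> N S" if v: "v \<in> N S" for v
        proof -
          have vT: "v \<in> T" using v by (simp add: N_def)
          have "s (w v) \<in> U" if s: "s \<in> S" for s
          proof -
            obtain c \<gamma> where c: "c \<in> W" "\<forall>v\<in>V. c v = s (w v) + scale \<gamma> (w (s v))"
              using weakly_closed_obtain[OF W(1), of s w] s SW w by blast
            then have "c \<in> C" using neg s by blast
            then have "c v \<in> U" using v NC by (auto simp: N_def)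
            moreover have "w (s v) \<in> U" using v s U(3) w by (auto simp: N_def)
            moreover have "s (w v) = c v - scale \<gamma> (w (s v))" using c(2) vT T(2) by auto
            ultimately show ?thesis using U(1) by (simp add: subspace_diff subspace_scale)
          qed
          moreover have "w v \<in> T" using T(3) w vT by auto
          ultimately show ?thesis by (simp add: N_def)
        qed
        then show False using w by (auto simp: C_def)
      qed
      have "nil_between U T S" using S(1) by (simp add: \<Omega>_def)
      then obtain n where n: "\<forall>ws\<in>lists S. length ws = n \<longrightarrow> apply_word ws ` T \<subseteq> U"
        unfolding nil_between_def by (elim exE)
      have long: "apply_word ws ` T \<subseteq> U" if "ws \<in> lists S" "n \<le> length ws" for ws
      proof (rule apply_word_long[OF _ _ that])
        show "apply_word ws ` T \<subseteq> U" if "ws \<in> lists S" "length ws = n" for ws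
          using n that by simp
        show "w ` T \<subseteq> T" if "w \<in> S" for w using T(3) SW that by auto
      qed
      have Sst: "apply_word ws ` X \<subseteq> X" if ws: "ws \<in> lists S" and X: "X = U \<or> X = T \<or> X = V" for ws X
      proof (rule apply_word_stable[OF _ ws])
        fix s assume "s \<in> S"
        then have "s \<in> W" using SW by auto
        then show "s ` X \<subseteq> X" using U(3) T(3) lin(2) X by blast
      qed
      have linS: "linear_on scale scale V (apply_word ws)" if "ws \<in> lists S" for ws
        using that
      proof (induction ws)
        case (Cons a ws)
        then have "linear_on scale scale V (apply_word ws)" "a \<in> W" "apply_word ws ` V \<subseteq> V"
          using SW Sst[of ws V] by auto
        then show ?case using lin(1)[of a] by (auto simp: linear_on_def image_subset_iff)
      qed (simp add: linear_on_def)
      \<comment> \<open>After \<open>k\<close> brackets with elements of \<open>S\<close>, an operator is a combination of products with \<open>k\<close>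
        factors from \<open>S\<close>, distributed on both sides. Padding to \<open>2 n\<close> factors leaves at least \<open>n\<close> of
        them on one side, which is enough to reach \<open>U\<close>.\<close>
      define Q where "Q k w \<longleftrightarrow> (\<forall>us\<in>lists S. \<forall>us'\<in>lists S. \<forall>t\<in>T.
        2 * n \<le> length us + length us' + k \<longrightarrow> apply_word us (w (apply_word us' t)) \<in> U)"
        for k w
      have descent: "\<exists>w. w \<in> W - C \<and> Q k w" if "C \<noteq> W" for k
      proof (induction k)
        case 0
        obtain w where w: "w \<in> W - C" using \<open>C \<noteq> W\<close> CW by auto
        \<comment> \<open>Only the longer of the two words is known to reach \<open>U\<close>; the rest stabilizes \<open>T\<close> or \<open>U\<close>.\<close>
        have "apply_word us (w (apply_word us' t)) \<in> U"
          if us: "us \<in> lists S" "us' \<in> lists S" "2 * n \<le> length us + length us'" "t \<in> T" for us us' t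
        proof (cases "n \<le> length us")
          case True
          have "w (apply_word us' t) \<in> T" using Sst[of us' T] us T(3) w by blast
          then show ?thesis using long[of us] True us by blast
        next
          case False
          then have "n \<le> length us'" using us(3) by linarith
          then have "w (apply_word us' t) \<in> U" using long[of us'] us U(3) w by blast
          then show ?thesis using Sst[of us U] us by blast
        qed
        then have "Q 0 w" unfolding Q_def by simp
        then show ?case using w by (intro exI conjI)
      next
        case (Suc k)
        then obtain w where wC: "w \<in> W - C" and Qw: "Q k w" by (elim exE conjE)
        have w: "apply_word us (w (apply_word us' t)) \<in> U"
          if "us \<in> lists S" "us' \<in> lists S" "t \<in> T" "2 * n \<le> length us + length us' + k" for us us' t
          using Qw[unfolded Q_def, rule_format, OF that] .
        obtain s \<gamma> c where c: "s \<in> S" "c \<in> W - C" "\<forall>v\<in>V. c v = s (w v) + scale \<gamma> (w (s v))"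
          using norm[OF wC] by (elim bexE exE)
        have "apply_word us (c (apply_word us' t)) \<in> U"
          if us: "us \<in> lists S" "us' \<in> lists S" "2 * n \<le> length us + length us' + Suc k" "t \<in> T" for us us' t
        proof -
          have V1: "apply_word us' t \<in> V" using Sst[of us' T] us T(2) by blast
          have V2: "w (apply_word us' t) \<in> V" "s (apply_word us' t) \<in> V"
            using V1 lin(2)[of w] lin(2)[of s] wC c(1) SW by auto
          have V3: "s (w (apply_word us' t)) \<in> V" "w (s (apply_word us' t)) \<in> V"
            using V2 lin(2)[of w] lin(2)[of s] wC c(1) SW by auto
          have "apply_word us (c (apply_word us' t)) =
            apply_word us (s (w (apply_word us' t))) + scale \<gamma> (apply_word us (w (s (apply_word us' t))))"
            using c(3) V1 V3 linear_onD[OF linS[OF us(1)]] fin(3) by (simp add: subspace_scale)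
          moreover have "apply_word (us @ [s]) (w (apply_word us' t)) \<in> U"
            using us c(1) by (intro w) auto
          moreover have "apply_word us (w (apply_word (s # us') t)) \<in> U"
            using us c(1) by (intro w) auto
          ultimately show ?thesis using U(1) by (simp add: subspace_add subspace_scale)
        qed
        then have "Q (Suc k) c" unfolding Q_def by simp
        then show ?case using c(2) by (intro exI conjI)
      qed
      have "C = W"
      proof (rule ccontr)
        assume "C \<noteq> W"
        then have "\<exists>w. w \<in> W - C \<and> Q (2 * n) w" by (rule descent)
        then obtain w where w: "w \<in> W - C" "Q (2 * n) w" by (elim exE conjE)
        have "w t \<in> U" if "t \<in> T" for t
          using w(2)[unfolded Q_def, rule_format, of "[]" "[]" t] that by simp
        then have "w ` N S \<subseteq> N S" using UN NT by blast
        then show False using w(1) by (simp add: C_def)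
      qed
      then show ?thesis using \<open>\<Omega> C\<close> by (simp add: \<Omega>_def)
    qed
  qed
qed

end

section \<open>Generalized eigenspaces of an operator on a subspace\<close>

definition shift_op :: "('k \<Rightarrow> 'v \<Rightarrow> 'v) \<Rightarrow> ('v \<Rightarrow> 'v) \<Rightarrow> 'k \<Rightarrow> 'v \<Rightarrow> 'v::ab_group_add" where
  "shift_op scale T \<mu> v = T v - scale \<mu> v"

definition generalized_eigenspace ::
  "('k \<Rightarrow> 'v \<Rightarrow> 'v) \<Rightarrow> 'v set \<Rightarrow> ('v \<Rightarrow> 'v) \<Rightarrow> 'k \<Rightarrow> 'v::ab_group_add set" where
  "generalized_eigenspace scale V T \<mu> = {v \<in> V. \<exists>n. (shift_op scale T \<mu> ^^ n) v = 0}"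

abbreviation shift_word :: "('k \<Rightarrow> 'v \<Rightarrow> 'v) \<Rightarrow> ('v \<Rightarrow> 'v) \<Rightarrow> 'k list \<Rightarrow> 'v \<Rightarrow> 'v::ab_group_add" where
  "shift_word scale T ms v \<equiv> fold (shift_op scale T) ms v"

locale operator_on_subspace = vector_space scale
  for scale :: "'k::{alg_closed_field, field_char_0} \<Rightarrow> 'v::ab_group_add \<Rightarrow> 'v" +
  fixes V :: "'v set" and T :: "'v \<Rightarrow> 'v"
  assumes subspace_V: "subspace V"
    and linear_T: "linear_on scale scale V T"
    and stable_T: "T ` V \<subseteq> V"
begin

abbreviation "S \<equiv> shift_op scale T"
abbreviation "E \<equiv> generalized_eigenspace scale V T"

lemma T_in: "v \<in> V \<Longrightarrow> T v \<in> V" using stable_T by auto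

lemma S_in: "v \<in> V \<Longrightarrow> S \<mu> v \<in> V"
  by (simp add: shift_op_def T_in subspace_V subspace_diff subspace_scale)

lemma linear_S: "linear_on scale scale V (S \<mu>)"
  using linear_onD[OF linear_T]
  by (auto simp: linear_on_def shift_op_def scale_right_distrib scale_right_diff_distrib mult.commute)

lemma S_0: "S \<mu> 0 = 0"
  using linear_on_0[OF linear_S subspace_V] .

lemma shift_word_in: "v \<in> V \<Longrightarrow> shift_word scale T ms v \<in> V"
  by (induction ms arbitrary: v) (auto simp: S_in)

lemma shift_word_0: "shift_word scale T ms 0 = 0"
  by (induction ms) (auto simp: S_0)

lemma linear_shift_word: "linear_on scale scale V (shift_word scale T ms)"
proof (induction ms)
  case (Cons m ms)
  then show ?case using linear_S[of m] S_in[of _ m] unfolding linear_on_def by simp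
qed (simp add: linear_on_def)

lemma S_power_in: "v \<in> V \<Longrightarrow> (S \<mu> ^^ n) v \<in> V"
  using funpow_stable[of "S \<mu>" V v n] S_in by auto

lemma S_power_0: "(S \<mu> ^^ n) 0 = 0"
  by (induction n) (auto simp: S_0)

lemma S_power_mono: "v \<in> V \<Longrightarrow> (S \<mu> ^^ n) v = 0 \<Longrightarrow> n \<le> m \<Longrightarrow> (S \<mu> ^^ m) v = 0"
  using funpow_add[of "m - n" n "S \<mu>"] S_power_0[of "m - n" \<mu>] by simp

lemma E_subset: "E \<mu> \<subseteq> V"
  by (auto simp: generalized_eigenspace_def)

lemma subspace_E: "subspace (E \<mu>)"
proof (rule subspaceI)
  show "0 \<in> E \<mu>" using subspace_V by (auto simp: generalized_eigenspace_def subspace_0 intro: exI[of _ 0])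
  have lin: "linear_on scale scale V (S \<mu> ^^ n)" for n
    using linear_on_funpow[OF linear_S] S_in by blast
  fix x y c assume "x \<in> E \<mu>" "y \<in> E \<mu>"
  then obtain m n where xy: "x \<in> V" "y \<in> V" "(S \<mu> ^^ m) x = 0" "(S \<mu> ^^ n) y = 0"
    by (auto simp: generalized_eigenspace_def)
  have "(S \<mu> ^^ max m n) (x + y) = 0"
    using xy S_power_mono[OF xy(1,3), of "max m n"] S_power_mono[OF xy(2,4), of "max m n"] linear_onD(1)[OF lin] by simp
  then show "x + y \<in> E \<mu>" using xy subspace_V by (auto simp: generalized_eigenspace_def subspace_add)
  have "(S \<mu> ^^ m) (scale c x) = 0" using xy linear_onD(2)[OF lin] by simp
  then show "scale c x \<in> E \<mu>" using xy subspace_V by (auto simp: generalized_eigenspace_def subspace_scale)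
qed

lemma E_S: "v \<in> V \<Longrightarrow> S \<mu> v \<in> E \<mu> \<Longrightarrow> v \<in> E \<mu>"
proof -
  assume v: "v \<in> V" "S \<mu> v \<in> E \<mu>"
  then obtain n where "(S \<mu> ^^ n) (S \<mu> v) = 0" by (auto simp: generalized_eigenspace_def)
  then have "(S \<mu> ^^ Suc n) v = 0" by (simp add: funpow_Suc_right del: funpow.simps)
  then show ?thesis using v by (auto simp only: generalized_eigenspace_def)
qed

text \<open>On the generalized eigenspace of \<open>\<nu> \<noteq> \<mu>\<close>, the operator \<open>T - \<mu>\<close> is the nonzero scalar \<open>\<nu> - \<mu>\<close> plus a
  nilpotent one, hence invertible; the solution is built by induction on the nilpotency.\<close>

lemma E_solve:
  assumes "\<mu> \<noteq> \<nu>" "u \<in> E \<nu>"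
  shows "\<exists>y\<in>E \<nu>. S \<mu> y = u"
proof -
  have "\<exists>y\<in>E \<nu>. S \<mu> y = u" if "u \<in> V" "(S \<nu> ^^ n) u = 0" for n u
    using that
  proof (induction n arbitrary: u)
    case 0
    then show ?case using S_0 subspace_0[OF subspace_E] by auto
  next
    case (Suc n)
    then have "(S \<nu> ^^ n) (S \<nu> u) = 0" by (simp add: funpow_Suc_right del: funpow.simps)
    then obtain y where y: "y \<in> E \<nu>" "S \<mu> y = S \<nu> u" using Suc S_in by blast
    have u: "u \<in> E \<nu>" using Suc.prems by (auto simp only: generalized_eigenspace_def)
    let ?z = "scale (1 / (\<nu> - \<mu>)) (u - y)"
    have yV: "y \<in> V" using y(1) E_subset by auto
    have "S \<mu> ?z = scale (1 / (\<nu> - \<mu>)) (S \<mu> u - S \<nu> u)"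
      using y(2) linear_onD(2)[OF linear_S] linear_on_diff[OF linear_S subspace_V] yV Suc.prems(1)
      by (simp add: subspace_V subspace_diff)
    also have "S \<mu> u - S \<nu> u = scale (\<nu> - \<mu>) u" by (simp add: shift_op_def scale_left_diff_distrib)
    also have "scale (1 / (\<nu> - \<mu>)) \<dots> = u" using assms(1) by simp
    finally show ?case using u y(1) subspace_E by (intro bexI[of _ ?z]) (auto simp: subspace_diff subspace_scale)
  qed
  then show ?thesis using assms(2) by (auto simp: generalized_eigenspace_def)
qed

text \<open>The usual Bezout argument is replaced by induction on the number of factors. If \<open>(T - \<mu>) v\<close> is a sum
  of generalized eigenvectors, then the summands for eigenvalues other than \<open>\<mu>\<close> are of the form
  \<open>(T - \<mu>) y\<close> with \<open>y\<close> in the span; subtracting the \<open>y\<close> from \<open>v\<close> leaves a generalized eigenvector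
  for \<open>\<mu>\<close>.\<close>

lemma killed_imp_span_eigen:
  assumes "v \<in> V" "shift_word scale T ms v = 0"
  shows "v \<in> span (\<Union>\<mu>. E \<mu>)"
  using assms
proof (induction ms arbitrary: v)
  case Nil
  then show ?case using span_zero by simp
next
  case (Cons \<mu> ms)
  let ?X = "span (\<Union>\<nu>. E \<nu>)"
  have XV: "?X \<subseteq> V" using E_subset subspace_V by (intro span_minimal) auto
  have split: "\<exists>y\<in>?X. \<exists>g\<in>E \<mu>. u = S \<mu> y + g" if "u \<in> ?X" for u
    using that
  proof (induction rule: span_induct_alt)
    case base
    show ?case using span_zero subspace_0[OF subspace_E] S_0 by (intro bexI[of _ 0]) auto
  next
    case (step c x u)
    then obtain y g where y: "y \<in> ?X" "g \<in> E \<mu>" "u = S \<mu> y + g" by blast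
    from step(1) obtain \<nu> where \<nu>: "x \<in> E \<nu>" by auto
    have "\<exists>y'\<in>?X. \<exists>g'\<in>E \<mu>. x = S \<mu> y' + g'"
    proof (cases "\<nu> = \<mu>")
      case True
      then show ?thesis using \<nu> span_zero S_0 by (intro bexI[of _ 0] bexI[of _ x]) auto
    next
      case False
      then obtain y' where "y' \<in> E \<nu>" "S \<mu> y' = x" using E_solve \<nu> by metis
      then show ?thesis using subspace_0[OF subspace_E]
        by (intro bexI[of _ y'] bexI[of _ 0]) (auto intro: span_base)
    qed
    then obtain y' g' where y': "y' \<in> ?X" "g' \<in> E \<mu>" "x = S \<mu> y' + g'" by blast
    have "scale c x + u = S \<mu> (scale c y' + y) + (scale c g' + g)"
      using y y' XV linear_onD[OF linear_S] subspace_V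
      by (simp add: subset_iff subspace_scale scale_right_distrib algebra_simps)
    moreover have "scale c y' + y \<in> ?X" using y y' by (simp add: span_add span_scale)
    moreover have "scale c g' + g \<in> E \<mu>" using y y' subspace_E by (simp add: subspace_add subspace_scale)
    ultimately show ?case by blast
  qed
  have "S \<mu> v \<in> ?X" using Cons S_in by simp
  then obtain y g where y: "y \<in> ?X" "g \<in> E \<mu>" "S \<mu> v = S \<mu> y + g" using split by blast
  have yV: "y \<in> V" using y XV by auto
  have "S \<mu> (v - y) \<in> E \<mu>" using y yV linear_on_diff[OF linear_S subspace_V] Cons.prems(1) by simp
  then have "v - y \<in> E \<mu>" using E_S[of "v - y"] yV Cons.prems(1) subspace_V by (simp add: subspace_diff)
  then have "v - y \<in> ?X" by (auto intro: span_base)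
  then show ?case using span_add[OF _ y(1)] by fastforce
qed

definition poly_apply :: "'k poly \<Rightarrow> 'v \<Rightarrow> 'v" where
  "poly_apply p v = (\<Sum>i\<le>degree p. scale (coeff p i) ((T ^^ i) v))"

lemma Tpow_in: "v \<in> V \<Longrightarrow> (T ^^ n) v \<in> V"
  using funpow_stable[of T V v n] stable_T by auto

lemma poly_apply_bound: "degree p \<le> n \<Longrightarrow> poly_apply p v = (\<Sum>i\<le>n. scale (coeff p i) ((T ^^ i) v))"
  unfolding poly_apply_def by (rule sum.mono_neutral_left) (auto simp: coeff_eq_0)

text \<open>Splitting off a root acts on the argument vector. This is all of the functional calculus that is
  needed to pass from an annihilating polynomial to a product of operators \<open>T - \<mu>\<close>.\<close>

lemma poly_apply_factor:
  assumes "v \<in> V"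
  shows "poly_apply ([:- \<mu>, 1:] * q) v = poly_apply q (S \<mu> v)"
proof -
  have lin: "linear_on scale scale V (T ^^ n)" for n
    using linear_on_funpow[OF linear_T stable_T] .
  have "degree ([:- \<mu>, 1:] * q) \<le> Suc (degree q)"
    using degree_mult_le[of "[:- \<mu>, 1:]" q] by simp
  then have "poly_apply ([:- \<mu>, 1:] * q) v =
      (\<Sum>i\<le>Suc (degree q). scale (coeff ([:- \<mu>, 1:] * q) i) ((T ^^ i) v))"
    by (rule poly_apply_bound)
  also have "\<dots> = (\<Sum>i\<le>Suc (degree q). scale (case i of 0 \<Rightarrow> 0 | Suc j \<Rightarrow> coeff q j) ((T ^^ i) v))
      - (\<Sum>i\<le>Suc (degree q). scale (\<mu> * coeff q i) ((T ^^ i) v))"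
    by (simp add: sum_subtractf[symmetric] coeff_pCons scale_left_diff_distrib scale_left_distrib
        del: sum.atMost_Suc split: nat.split cong: sum.cong)
  also have "(\<Sum>i\<le>Suc (degree q). scale (case i of 0 \<Rightarrow> 0 | Suc j \<Rightarrow> coeff q j) ((T ^^ i) v))
      = poly_apply q (T v)"
    by (simp add: sum.atMost_Suc_shift poly_apply_def funpow_swap1 del: sum.atMost_Suc)
  also have "(\<Sum>i\<le>Suc (degree q). scale (\<mu> * coeff q i) ((T ^^ i) v)) = poly_apply q (scale \<mu> v)"
    using assms linear_onD(2)[OF lin] by (simp add: poly_apply_def coeff_eq_0 mult.commute)
  also have "poly_apply q (T v) - poly_apply q (scale \<mu> v) = poly_apply q (S \<mu> v)"
    using assms linear_on_diff[OF lin subspace_V] T_in subspace_V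
    by (simp add: poly_apply_def shift_op_def sum_subtractf[symmetric] scale_right_diff_distrib subspace_scale)
  finally show ?thesis .
qed

lemma poly_apply_killed:
  assumes "p \<noteq> 0"
  shows "\<exists>ms. \<forall>v\<in>V. poly_apply p v = 0 \<longrightarrow> shift_word scale T ms v = 0"
  using assms
proof (induction "degree p" arbitrary: p)
  case 0
  then have "poly_apply p v = scale (coeff p 0) v" for v by (simp add: poly_apply_def)
  moreover have "coeff p 0 \<noteq> 0" using 0 leading_coeff_neq_0[of p] by simp
  ultimately
  show ?case by (intro exI[of _ "[]"]) auto
next
  case (Suc n)
  then obtain \<mu> where "poly p \<mu> = 0" using alg_closed_imp_poly_has_root[of p] by auto
  then obtain q where q: "p = [:- \<mu>, 1:] * q" by (auto simp: poly_eq_0_iff_dvd elim: dvdE)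
  have "q \<noteq> 0" using Suc.prems q by auto
  then have "degree q = n" using Suc(2) q degree_mult_eq[of "[:- \<mu>, 1:]" q] by simp
  then obtain ms where ms: "\<forall>v\<in>V. poly_apply q v = 0 \<longrightarrow> shift_word scale T ms v = 0"
    using Suc(1)[of q] \<open>q \<noteq> 0\<close> by auto
  have "shift_word scale T (\<mu> # ms) v = 0" if "v \<in> V" "poly_apply p v = 0" for v
    using ms that S_in[OF that(1)] poly_apply_factor[OF that(1)] q by simp
  then show ?case by blast
qed

context
  fixes A assumes fin: "finite A" "V \<subseteq> span A"
begin

text \<open>The iterates \<open>T\<^sup>i v\<close> are too many to be independent. If two of them coincide, the polynomial is the
  difference of the two monomials, because a set of iterates would not see the coincidence.\<close>

lemma poly_apply_exists:
  assumes "v \<in> V"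
  shows "\<exists>p. p \<noteq> 0 \<and> poly_apply p v = 0"
proof (cases "inj_on (\<lambda>i. (T ^^ i) v) {..card A}")
  case True
  let ?B = "(\<lambda>i. (T ^^ i) v) ` {..card A}"
  have "card ?B = Suc (card A)" using True by (simp add: card_image)
  moreover have "?B \<subseteq> span A" using Tpow_in[OF assms] fin by auto
  ultimately have "dependent ?B" using independent_span_bound[OF fin(1), of ?B] by auto
  then obtain u where u: "\<exists>b\<in>?B. u b \<noteq> 0" "(\<Sum>b\<in>?B. scale (u b) b) = 0"
    using dependent_finite[of ?B] by auto
  define p where "p = (\<Sum>i\<le>card A. monom (u ((T ^^ i) v)) i)"
  have cp: "coeff p i = (if i \<le> card A then u ((T ^^ i) v) else 0)" for i
    by (auto simp: p_def coeff_sum coeff_monom)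
  have "degree p \<le> card A" using cp by (intro degree_le) auto
  then have "poly_apply p v = (\<Sum>i\<le>card A. scale (u ((T ^^ i) v)) ((T ^^ i) v))"
    by (simp add: poly_apply_bound cp)
  also have "\<dots> = 0" using u(2) True by (simp add: sum.reindex)
  finally have "poly_apply p v = 0" .
  moreover obtain i where "i \<le> card A" "u ((T ^^ i) v) \<noteq> 0" using u(1) by auto
  then have "coeff p i \<noteq> 0" by (simp add: cp)
  then have "p \<noteq> 0" by auto
  ultimately show ?thesis by blast
next
  case False
  then obtain i j where ij: "i < j" "(T ^^ i) v = (T ^^ j) v"
    by (auto simp: inj_on_def) (metis linorder_neqE_nat)
  define p where "p = monom 1 j - monom (1 :: 'k) i"
  have "coeff p j \<noteq> 0" using ij by (simp add: p_def)
  then have "p \<noteq> 0" by auto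
  moreover have "degree p \<le> j" using ij by (intro degree_le) (auto simp: p_def)
  then have "poly_apply p v = (\<Sum>k\<le>j. scale (coeff (monom 1 j) k) ((T ^^ k) v))
      - (\<Sum>k\<le>j. scale (coeff (monom 1 i) k) ((T ^^ k) v))"
    by (simp add: poly_apply_bound p_def scale_left_diff_distrib sum_subtractf)
  moreover have "(\<Sum>k\<le>j. scale (coeff (monom 1 l) k) ((T ^^ k) v)) = (T ^^ l) v" if "l \<le> j" for l
  proof -
    have "(\<Sum>k\<le>j. scale (coeff (monom 1 l) k) ((T ^^ k) v)) = (\<Sum>k\<in>{l}. scale (coeff (monom 1 l) k) ((T ^^ k) v))"
      using that by (intro sum.mono_neutral_right) auto
    then show ?thesis by simp
  qed
  ultimately show ?thesis using ij by auto
qed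

lemma killed_exists: "v \<in> V \<Longrightarrow> \<exists>ms. shift_word scale T ms v = 0"
  using poly_apply_exists poly_apply_killed by metis

theorem span_generalized_eigenspaces: "V \<subseteq> span (\<Union>\<mu>. E \<mu>)"
  using killed_exists killed_imp_span_eigen by blast

lemma killed_all: "\<exists>ms. \<forall>v\<in>V. shift_word scale T ms v = 0"
proof -
  obtain B where B: "finite B" "B \<subseteq> V" "V \<subseteq> span B"
    using finite_basis_exists[OF fin] by metis
  from B(1,2) have "\<exists>ms. \<forall>b\<in>B. shift_word scale T ms b = 0"
  proof (induction B rule: finite_induct)
    case (insert b B)
    then obtain ms where ms: "\<forall>b\<in>B. shift_word scale T ms b = 0" by auto
    have "shift_word scale T ms b \<in> V" using insert.prems shift_word_in by auto
    then obtain ns where "shift_word scale T ns (shift_word scale T ms b) = 0"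
      using killed_exists by blast
    then have "\<forall>x\<in>insert b B. shift_word scale T (ms @ ns) x = 0" using ms by (simp add: shift_word_0)
    then show ?case by blast
  qed simp
  then obtain ms where ms: "\<forall>b\<in>B. shift_word scale T ms b = 0" by blast
  have "linear_on scale scale V (\<lambda>_. 0)" by (simp add: linear_on_def)
  then have "\<forall>v\<in>V. shift_word scale T ms v = 0"
    using linear_on_eq_on_span[OF linear_shift_word _ subspace_V B(2), of "\<lambda>_. 0"] ms B(3) by blast
  then show ?thesis by blast
qed

lemma eigenvector_in_E:
  assumes "v \<in> E \<mu>" "v \<noteq> 0"
  obtains w n where "w = (S \<mu> ^^ n) v" "w \<in> V" "w \<noteq> 0" "T w = scale \<mu> w"
proof -
  have ex: "\<exists>n. (S \<mu> ^^ n) v = 0" "v \<in> V" using assms(1) by (auto simp: generalized_eigenspace_def)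
  define n where "n = (LEAST n. (S \<mu> ^^ n) v = 0)"
  have n: "(S \<mu> ^^ n) v = 0" "\<And>m. m < n \<Longrightarrow> (S \<mu> ^^ m) v \<noteq> 0"
    unfolding n_def using LeastI_ex[OF ex(1)] not_less_Least by auto
  obtain m where m: "n = Suc m" using n(1) assms(2) by (cases n) auto
  show thesis
  proof (rule that[OF refl])
    show "(S \<mu> ^^ m) v \<in> V" using S_power_in[OF ex(2)] .
    show "(S \<mu> ^^ m) v \<noteq> 0" using n(2)[of m] m by simp
    have "S \<mu> ((S \<mu> ^^ m) v) = 0" using n(1) m by simp
    then show "T ((S \<mu> ^^ m) v) = scale \<mu> ((S \<mu> ^^ m) v)" by (simp add: shift_op_def)
  qed
qed

theorem eigenvector_exists:
  assumes "V \<noteq> {0}"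
  obtains w \<mu> where "w \<in> V" "w \<noteq> 0" "T w = scale \<mu> w"
proof -
  have "\<exists>\<mu>. \<exists>v\<in>E \<mu>. v \<noteq> 0"
  proof (rule ccontr)
    assume "\<not> ?thesis"
    then have "(\<Union>\<mu>. E \<mu>) \<subseteq> {0}" by auto
    then have "span (\<Union>\<mu>. E \<mu>) \<subseteq> {0}" by (rule span_minimal) simp
    then show False using span_generalized_eigenspaces assms subspace_0[OF subspace_V] by auto
  qed
  then obtain v \<mu> where v: "v \<in> E \<mu>" "v \<noteq> 0" by blast
  show thesis by (rule eigenvector_in_E[OF v]) (rule that)
qed

text \<open>A product of operators \<open>T - m\<^sub>i\<close> that vanishes on \<open>V\<close> acts on an eigenvector as the product of the
  scalars \<open>\<mu> - m\<^sub>i\<close>, so every eigenvalue \<open>\<mu>\<close> is one of the \<open>m\<^sub>i\<close>.\<close>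

theorem finite_spectrum: "finite {\<mu>. E \<mu> \<noteq> {0}}"
proof -
  obtain ms where ms: "\<forall>v\<in>V. shift_word scale T ms v = 0" using killed_all by blast
  have "\<mu> \<in> set ms" if E: "E \<mu> \<noteq> {0}" for \<mu>
  proof -
    obtain v where v: "v \<in> E \<mu>" "v \<noteq> 0" using E subspace_0[OF subspace_E] by blast
    obtain w where w: "w \<in> V" "w \<noteq> 0" "T w = scale \<mu> w" by (rule eigenvector_in_E[OF v])
    have "\<mu> \<in> set ns \<or> x = 0" if "shift_word scale T ns x = 0" "x \<in> V" "T x = scale \<mu> x" for ns x
      using that
    proof (induction ns arbitrary: x)
      case (Cons n ns)
      have "S n x = scale (\<mu> - n) x" using Cons.prems(3) by (simp add: shift_op_def scale_left_diff_distrib)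
      moreover have "T (S n x) = scale \<mu> (S n x)"
        unfolding \<open>S n x = _\<close> using Cons.prems linear_onD(2)[OF linear_T] by (simp add: mult.commute)
      ultimately show ?case using Cons.IH[of "S n x"] Cons.prems S_in[OF Cons.prems(2), of n] by auto
    qed simp
    then show ?thesis using w ms by blast
  qed
  then have "{\<mu>. E \<mu> \<noteq> {0}} \<subseteq> set ms" by blast
  then show ?thesis by (rule finite_subset) simp
qed

end

end

section \<open>Calculus in an even-quadratic odd-symplectic Lie superalgebra\<close>

lemma bit_cases: "(a::bit) = 0 \<or> a = 1"
  by (cases a) auto

lemma sgn_pow_simps [simp]: "sgn_pow 0 = 1" "sgn_pow 1 = - 1"
  by (simp_all add: sgn_pow_def)

text \<open>Identities are proved for homogeneous elements and then stated for arbitrary ones with the parity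
  involution \<open>\<sigma>\<close> in place of signs; most of the later computations then need no case
  distinction on degrees.\<close>

locale quadratic_symplectic =
  fixes G :: "('k::field_char_0, 'v::ab_group_add) qs_superalgebra"
  assumes eqos: "even_quadratic_odd_symplectic G"
begin

abbreviation "V \<equiv> carrier G"
abbreviation "V0 \<equiv> grade G 0"
abbreviation "V1 \<equiv> grade G 1"
abbreviation "br \<equiv> bracket G"
abbreviation "B \<equiv> qform G"
abbreviation "\<omega> \<equiv> sform G"
abbreviation "\<sigma> \<equiv> parity_inv G"

lemma lie_G: "lie_superalgebra G" and scalar_product_G: "even_invariant_scalar_product G B"
  and symplectic_G: "odd_symplectic_form G \<omega>"
  using eqos by (auto simp: even_quadratic_odd_symplectic_def)

lemma superspace_G: "finite_dim_superspace G"
  using lie_G by (simp add: lie_superalgebra_def)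

sublocale vector_space "smult G"
  using superspace_G by (simp add: finite_dim_superspace_def)

lemma subspace_grade: "subspace (grade G a)"
  using superspace_G by (simp add: finite_dim_superspace_def)

lemma grade_Int: "x \<in> V0 \<Longrightarrow> x \<in> V1 \<Longrightarrow> x = 0"
  using superspace_G by (auto simp: finite_dim_superspace_def)

lemma subspace_V: "subspace V"
  unfolding carrier_def using subspace_sums[OF subspace_grade subspace_grade] .

lemma finite_spanning: obtains A where "finite A" "V \<subseteq> span A"
  using superspace_G unfolding finite_dim_superspace_def by blast

lemma grade_V: "x \<in> grade G a \<Longrightarrow> x \<in> V"
proof -
  assume x: "x \<in> grade G a"
  have "x = x + 0" "x = 0 + x" by auto
  then show ?thesis
    unfolding carrier_def using x bit_cases[of a] subspace_0[OF subspace_grade] by blast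
qed

lemma V0_V [simp]: "x \<in> V0 \<Longrightarrow> x \<in> V" and V1_V [simp]: "x \<in> V1 \<Longrightarrow> x \<in> V"
  by (auto intro: grade_V)

lemma V_cases:
  assumes "x \<in> V"
  obtains x0 x1 where "x0 \<in> V0" "x1 \<in> V1" "x = x0 + x1"
  using assms by (auto simp: carrier_def)

lemma V_closed [simp]:
  "0 \<in> V" "x \<in> V \<Longrightarrow> y \<in> V \<Longrightarrow> x + y \<in> V" "x \<in> V \<Longrightarrow> y \<in> V \<Longrightarrow> x - y \<in> V"
  "x \<in> V \<Longrightarrow> - x \<in> V" "x \<in> V \<Longrightarrow> smult G c x \<in> V"
  using subspace_V by (auto simp: subspace_0 subspace_add subspace_diff subspace_neg subspace_scale)

lemma grade_closed [simp]:
  "0 \<in> grade G a" "x \<in> grade G a \<Longrightarrow> y \<in> grade G a \<Longrightarrow> x + y \<in> grade G a"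
  "x \<in> grade G a \<Longrightarrow> y \<in> grade G a \<Longrightarrow> x - y \<in> grade G a"
  "x \<in> grade G a \<Longrightarrow> - x \<in> grade G a" "x \<in> grade G a \<Longrightarrow> smult G c x \<in> grade G a"
  using subspace_grade by (auto simp: subspace_0 subspace_add subspace_diff subspace_neg subspace_scale)

lemma grade_unique:
  assumes "x0 \<in> V0" "x1 \<in> V1" "y0 \<in> V0" "y1 \<in> V1" "x0 + x1 = y0 + y1"
  shows "x0 = y0" "x1 = y1"
proof -
  have "x0 - y0 = y1 - x1" using assms(5) by (simp add: algebra_simps)
  moreover have "x0 - y0 \<in> V0" "y1 - x1 \<in> V1" using assms by auto
  ultimately show "x0 = y0" using grade_Int[of "x0 - y0"] by simp
  then show "x1 = y1" using assms(5) by simp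
qed

lemma component_sum:
  assumes "x0 \<in> V0" "x1 \<in> V1"
  shows "component G 0 (x0 + x1) = x0" "component G 1 (x0 + x1) = x1"
proof -
  show "component G 0 (x0 + x1) = x0" unfolding component_def
  proof (rule the_equality)
    fix y assume y: "y \<in> V0 \<and> x0 + x1 - y \<in> grade G (0 + 1)"
    then have "x0 + x1 - y \<in> V1" by simp
    then have "x0 = y" by (rule grade_unique(1)[OF assms conjunct1[OF y]]) simp
    then show "y = x0" by simp
  qed (use assms in auto)
  show "component G 1 (x0 + x1) = x1" unfolding component_def
  proof (rule the_equality)
    fix y assume y: "y \<in> V1 \<and> x0 + x1 - y \<in> grade G (1 + 1)"
    then have "x0 + x1 - y \<in> V0" by simp
    then have "x1 = y" by (rule grade_unique(2)[OF assms _ conjunct1[OF y]]) simp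
    then show "y = x1" by simp
  qed (use assms in auto)
qed

lemma \<sigma>_sum: "x0 \<in> V0 \<Longrightarrow> x1 \<in> V1 \<Longrightarrow> \<sigma> (x0 + x1) = x0 - x1"
  by (simp add: parity_inv_def component_sum)

lemma \<sigma>_even [simp]: "x \<in> V0 \<Longrightarrow> \<sigma> x = x" and \<sigma>_odd [simp]: "x \<in> V1 \<Longrightarrow> \<sigma> x = - x"
  using \<sigma>_sum[of x 0] \<sigma>_sum[of 0 x] by auto

lemma \<sigma>_V [simp]: "x \<in> V \<Longrightarrow> \<sigma> x \<in> V"
  by (erule V_cases) (simp add: \<sigma>_sum)

lemma \<sigma>_\<sigma> [simp]: "x \<in> V \<Longrightarrow> \<sigma> (\<sigma> x) = x"
proof (erule V_cases)
  fix x0 x1 assume "x0 \<in> V0" "x1 \<in> V1" "x = x0 + x1"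
  then show ?thesis using \<sigma>_sum[of x0 "- x1"] by (simp add: \<sigma>_sum)
qed

lemma bilinear_br: "bilinear_on (smult G) (smult G) V br"
  using lie_G by (simp add: lie_superalgebra_def)

lemma bilinear_B: "bilinear_on (smult G) (*) V B"
  using scalar_product_G by (simp add: even_invariant_scalar_product_def bilinear_form_def)

lemma bilinear_\<omega>: "bilinear_on (smult G) (*) V \<omega>"
  using symplectic_G by (simp add: odd_symplectic_form_def bilinear_form_def)

lemma linear_br: "x \<in> V \<Longrightarrow> linear_on (smult G) (smult G) V (br x)"
    "y \<in> V \<Longrightarrow> linear_on (smult G) (smult G) V (\<lambda>x. br x y)"
  using bilinear_br by (auto simp: bilinear_on_def)

lemma linear_B: "x \<in> V \<Longrightarrow> linear_on (smult G) (*) V (B x)"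
    "y \<in> V \<Longrightarrow> linear_on (smult G) (*) V (\<lambda>x. B x y)"
  using bilinear_B by (auto simp: bilinear_on_def)

lemma linear_\<omega>: "x \<in> V \<Longrightarrow> linear_on (smult G) (*) V (\<omega> x)"
    "y \<in> V \<Longrightarrow> linear_on (smult G) (*) V (\<lambda>x. \<omega> x y)"
  using bilinear_\<omega> by (auto simp: bilinear_on_def)

lemmas br_linear [simp] =
  linear_onD[OF linear_br(1)] linear_onD[OF linear_br(2)]
  linear_on_0[OF linear_br(1) subspace_V] linear_on_0[OF linear_br(2) subspace_V]
  linear_on_neg[OF linear_br(1) subspace_V] linear_on_neg[OF linear_br(2) subspace_V]
  linear_on_diff[OF linear_br(1) subspace_V] linear_on_diff[OF linear_br(2) subspace_V]

lemmas B_linear [simp] =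
  linear_onD[OF linear_B(1)] linear_onD[OF linear_B(2)]
  linear_on_0[OF linear_B(1) subspace_V] linear_on_0[OF linear_B(2) subspace_V]
  linear_on_neg[OF linear_B(1) subspace_V] linear_on_neg[OF linear_B(2) subspace_V]
  linear_on_diff[OF linear_B(1) subspace_V] linear_on_diff[OF linear_B(2) subspace_V]

lemma br_grade: "x \<in> grade G a \<Longrightarrow> y \<in> grade G b \<Longrightarrow> br x y \<in> grade G (a + b)"
  using lie_G unfolding lie_superalgebra_def by blast

lemma br_parity [simp]:
  "x \<in> V0 \<Longrightarrow> y \<in> V0 \<Longrightarrow> br x y \<in> V0" "x \<in> V0 \<Longrightarrow> y \<in> V1 \<Longrightarrow> br x y \<in> V1"
  "x \<in> V1 \<Longrightarrow> y \<in> V0 \<Longrightarrow> br x y \<in> V1" "x \<in> V1 \<Longrightarrow> y \<in> V1 \<Longrightarrow> br x y \<in> V0"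
  using br_grade[of x 0 y 0] br_grade[of x 0 y 1] br_grade[of x 1 y 0] br_grade[of x 1 y 1] by auto

lemma br_V [simp]: "x \<in> V \<Longrightarrow> y \<in> V \<Longrightarrow> br x y \<in> V"
  by (elim V_cases) simp

lemma br_swap: "x \<in> grade G a \<Longrightarrow> y \<in> grade G b \<Longrightarrow> br x y = smult G (- sgn_pow (a * b)) (br y x)"
  using lie_G unfolding lie_superalgebra_def by blast

lemma br_even: "e \<in> V0 \<Longrightarrow> y \<in> V \<Longrightarrow> br y e = - br e y"
proof (elim V_cases)
  fix y0 y1 assume "e \<in> V0" "y0 \<in> V0" "y1 \<in> V1" "y = y0 + y1"
  then show ?thesis using br_swap[of y0 0 e 0] br_swap[of y1 1 e 0] by simp
qed

lemma br_odd: "o' \<in> V1 \<Longrightarrow> y \<in> V \<Longrightarrow> br y o' = - br o' (\<sigma> y)"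
proof (elim V_cases)
  fix y0 y1 assume "o' \<in> V1" "y0 \<in> V0" "y1 \<in> V1" "y = y0 + y1"
  then show ?thesis using br_swap[of y0 0 o' 1] br_swap[of y1 1 o' 1] by (simp add: \<sigma>_sum)
qed

lemma br_\<sigma>: "x \<in> V \<Longrightarrow> y \<in> V \<Longrightarrow> \<sigma> (br x y) = br (\<sigma> x) (\<sigma> y)"
proof (elim V_cases)
  fix x0 x1 y0 y1 assume *: "x0 \<in> V0" "x1 \<in> V1" "x = x0 + x1" "y0 \<in> V0" "y1 \<in> V1" "y = y0 + y1"
  have "br x y = (br x0 y0 + br x1 y1) + (br x0 y1 + br x1 y0)" using * by (simp add: ac_simps)
  also have "\<sigma> \<dots> = (br x0 y0 + br x1 y1) - (br x0 y1 + br x1 y0)" using * by (intro \<sigma>_sum) auto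
  finally show ?thesis using * by (simp add: \<sigma>_sum algebra_simps)
qed

lemma jacobi:
  assumes "x \<in> grade G a" "y \<in> grade G b" "z \<in> grade G c"
  shows "smult G (sgn_pow (c * a)) (br x (br y z)) + smult G (sgn_pow (a * b)) (br y (br z x)) +
        smult G (sgn_pow (b * c)) (br z (br x y)) = 0"
  using lie_G assms unfolding lie_superalgebra_def by blast

lemma jacobi_even_homogeneous:
  assumes "e \<in> V0" "x \<in> grade G a" "y \<in> grade G b"
  shows "br e (br x y) = br (br e x) y + br x (br e y)"
proof -
  have "x \<in> V" "y \<in> V" using assms(2,3) by (auto intro: grade_V)
  moreover have "br e x \<in> grade G a" using br_grade[OF assms(1,2)] bit_cases[of a] by auto
  ultimately show ?thesis
    using jacobi[OF assms] br_even[OF assms(1), of y] br_swap[OF \<open>br e x \<in> _\<close> assms(3)] assms(1)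
    by (simp add: algebra_simps add_eq_0_iff)
qed

lemma jacobi_even:
  assumes "e \<in> V0" "x \<in> V" "y \<in> V"
  shows "br e (br x y) = br (br e x) y + br x (br e y)"
  using assms(2,3)
proof (elim V_cases)
  fix x0 x1 y0 y1 assume *: "x0 \<in> V0" "x1 \<in> V1" "x = x0 + x1" "y0 \<in> V0" "y1 \<in> V1" "y = y0 + y1"
  then show ?thesis using assms(1)
    by (simp add: jacobi_even_homogeneous[of e x0 0 y0 0] jacobi_even_homogeneous[of e x0 0 y1 1]
        jacobi_even_homogeneous[of e x1 1 y0 0] jacobi_even_homogeneous[of e x1 1 y1 1])
qed

lemma jacobi_odd_homogeneous:
  assumes "e \<in> V1" "x \<in> grade G a" "y \<in> grade G b"
  shows "br e (br x y) = br (br e x) y + smult G (sgn_pow a) (br x (br e y))"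
proof -
  have V: "x \<in> V" "y \<in> V" "e \<in> V" using assms by (auto intro: grade_V)
  have sw: "br (br e x) y = smult G (- sgn_pow ((1 + a) * b)) (br y (br e x))"
    "br y e = smult G (- sgn_pow b) (br e y)"
    using br_swap[OF br_grade[OF assms(1,2)] assms(3)] br_swap[OF assms(3,1)] by simp_all
  show ?thesis
    using jacobi[OF assms] V bit_cases[of a] bit_cases[of b] unfolding sw
    by (auto simp: algebra_simps eq_neg_iff_add_eq_0 neg_eq_iff_add_eq_0 diff_eq_eq eq_diff_eq)
qed

lemma jacobi_odd:
  assumes "e \<in> V1" "x \<in> V" "y \<in> V"
  shows "br e (br x y) = br (br e x) y + br (\<sigma> x) (br e y)"
  using assms(2,3)
proof (elim V_cases)
  fix x0 x1 y0 y1 assume *: "x0 \<in> V0" "x1 \<in> V1" "x = x0 + x1" "y0 \<in> V0" "y1 \<in> V1" "y = y0 + y1"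
  then show ?thesis using assms(1)
    by (simp add: \<sigma>_sum jacobi_odd_homogeneous[of e x0 0 y0 0] jacobi_odd_homogeneous[of e x0 0 y1 1]
        jacobi_odd_homogeneous[of e x1 1 y0 0] jacobi_odd_homogeneous[of e x1 1 y1 1])
qed

lemma B_invariant: "x \<in> V \<Longrightarrow> y \<in> V \<Longrightarrow> z \<in> V \<Longrightarrow> B (br x y) z = B x (br y z)"
  using scalar_product_G unfolding even_invariant_scalar_product_def invariant_form_def by blast

lemma B_parity [simp]: "x \<in> V0 \<Longrightarrow> y \<in> V1 \<Longrightarrow> B x y = 0" "x \<in> V1 \<Longrightarrow> y \<in> V0 \<Longrightarrow> B x y = 0"
  using scalar_product_G by (auto simp: even_invariant_scalar_product_def even_form_def)

lemma B_swap: "x \<in> grade G a \<Longrightarrow> y \<in> grade G b \<Longrightarrow> B x y = sgn_pow (a * b) * B y x"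
  using scalar_product_G unfolding even_invariant_scalar_product_def supersymmetric_def by blast

lemma B_even: "e \<in> V0 \<Longrightarrow> y \<in> V \<Longrightarrow> B y e = B e y"
proof (elim V_cases)
  fix y0 y1 assume "e \<in> V0" "y0 \<in> V0" "y1 \<in> V1" "y = y0 + y1"
  then show ?thesis using B_swap[of y0 0 e 0] by simp
qed

lemma B_odd: "o' \<in> V1 \<Longrightarrow> y \<in> V \<Longrightarrow> B y o' = - B o' y"
proof (elim V_cases)
  fix y0 y1 assume "o' \<in> V1" "y0 \<in> V0" "y1 \<in> V1" "y = y0 + y1"
  then show ?thesis using B_swap[of y1 1 o' 1] by simp
qed

lemma B_odd_self: "x \<in> V1 \<Longrightarrow> B x x = 0"
proof -
  assume "x \<in> V1"
  then have "B x x + B x x = 0" using B_odd[of x x] by simp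
  then have "2 * B x x = 0" by (simp only: mult_2)
  then show ?thesis by simp
qed

lemma B_\<sigma>: "x \<in> V \<Longrightarrow> y \<in> V \<Longrightarrow> B (\<sigma> x) y = B x (\<sigma> y)"
  by (elim V_cases) (simp add: \<sigma>_sum)

lemma B_nondegenerate: "x \<in> V \<Longrightarrow> (\<And>y. y \<in> V \<Longrightarrow> B x y = 0) \<Longrightarrow> x = 0"
  using scalar_product_G unfolding even_invariant_scalar_product_def nondegenerate_def by blast

lemma B_eqI:
  assumes "x \<in> V" "y \<in> V" "\<And>a z. z \<in> grade G a \<Longrightarrow> B x z = B y z"
  shows "x = y"
proof -
  have "x - y = 0"
  proof (rule B_nondegenerate)
    fix z assume "z \<in> V"
    then obtain z0 z1 where "z0 \<in> V0" "z1 \<in> V1" "z = z0 + z1" by (rule V_cases)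
    then show "B (x - y) z = 0" using assms(1,2) assms(3)[of z0 0] assms(3)[of z1 1] by simp
  qed (use assms in simp)
  then show ?thesis by simp
qed

lemma \<omega>_swap: "x \<in> grade G a \<Longrightarrow> y \<in> grade G b \<Longrightarrow> \<omega> x y = - sgn_pow (a * b) * \<omega> y x"
  using symplectic_G unfolding odd_symplectic_form_def skew_supersymmetric_form_def by blast

lemma \<omega>_closed:
  assumes "x \<in> grade G a" "y \<in> grade G b" "z \<in> grade G c"
  shows "sgn_pow (c * a) * \<omega> x (br y z) + sgn_pow (a * b) * \<omega> y (br z x) +
        sgn_pow (b * c) * \<omega> z (br x y) = 0"
  using symplectic_G assms unfolding odd_symplectic_form_def by blast

lemma \<omega>_odd: "x \<in> grade G a \<Longrightarrow> y \<in> grade G a \<Longrightarrow> \<omega> x y = 0"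
  using symplectic_G unfolding odd_symplectic_form_def odd_form_def by blast

lemma \<omega>_nondegenerate: "x \<in> V \<Longrightarrow> (\<And>y. y \<in> V \<Longrightarrow> \<omega> x y = 0) \<Longrightarrow> x = 0"
  using symplectic_G unfolding odd_symplectic_form_def nondegenerate_def by blast

lemma B_represents:
  assumes "linear_on (smult G) (*) V \<phi>"
  shows "\<exists>x\<in>V. \<forall>y\<in>V. B x y = \<phi> y"
  using finite_spanning nondegenerate_represents[OF _ _ subspace_V bilinear_B _ assms] B_nondegenerate
  by metis

lemma \<omega>_represents:
  assumes "linear_on (smult G) (*) V \<phi>"
  shows "\<exists>x\<in>V. \<forall>y\<in>V. \<omega> x y = \<phi> y"
  using finite_spanning nondegenerate_represents[OF _ _ subspace_V bilinear_\<omega> _ assms] \<omega>_nondegenerate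
  by metis

end

section \<open>The odd superderivation and the center\<close>

context quadratic_symplectic
begin

text \<open>The vector \<open>\<delta> x\<close> represents the functional \<open>\<omega>(x, \<cdot>)\<close> with respect to \<open>B\<close>. Since \<open>\<omega>\<close> is odd and \<open>B\<close>
  even, \<open>\<delta>\<close> is odd; paired with a third element, the derivation rule becomes the cocycle condition
  for \<open>\<omega>\<close>; and \<open>\<delta>\<close> is bijective because both forms are nondegenerate.\<close>

lemma associated_superderivation_exists: "\<exists>\<delta>. associated_superderivation G \<delta>"
proof -
  have "\<forall>x\<in>V. \<exists>u. u \<in> V \<and> (\<forall>y\<in>V. B u y = \<omega> x y)"
    using B_represents[OF linear_\<omega>(1)] by blast
  then obtain \<delta> where \<delta>: "\<forall>x\<in>V. \<delta> x \<in> V \<and> (\<forall>y\<in>V. B (\<delta> x) y = \<omega> x y)"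
    by (rule bchoice[THEN exE])
  have \<delta>V: "\<delta> x \<in> V" if "x \<in> V" for x using \<delta> that by simp
  have \<delta>B: "B (\<delta> x) y = \<omega> x y" if "x \<in> V" "y \<in> V" for x y using \<delta> that by simp
  have \<omega>_linear: "\<omega> (x + y) z = \<omega> x z + \<omega> y z" "\<omega> (smult G c x) z = c * \<omega> x z"
    if "x \<in> V" "y \<in> V" "z \<in> V" for x y z c
    using linear_onD[OF linear_\<omega>(2)[OF that(3)]] that by auto
  have \<delta>_add: "\<delta> (x + y) = \<delta> x + \<delta> y" if "x \<in> V" "y \<in> V" for x y
    using that grade_V by (intro B_eqI) (auto simp: \<delta>V \<delta>B \<omega>_linear)
  have \<delta>_scale: "\<delta> (smult G c x) = smult G c (\<delta> x)" if "x \<in> V" for x c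
    using that grade_V by (intro B_eqI) (auto simp: \<delta>V \<delta>B \<omega>_linear)
  have \<delta>_0: "\<delta> x \<in> V1" if x: "x \<in> V0" for x
  proof -
    obtain u0 u1 where u: "u0 \<in> V0" "u1 \<in> V1" "\<delta> x = u0 + u1" using V_cases \<delta>V x V0_V by metis
    have "B u0 y = 0" if y: "y \<in> V" for y
    proof -
      obtain y0 y1 where y: "y0 \<in> V0" "y1 \<in> V1" "y = y0 + y1" using V_cases[OF y] .
      have "B (\<delta> x) y0 = 0" using \<delta>B[of x y0] \<omega>_odd[of x 0 y0] x y by simp
      then show ?thesis using u y by simp
    qed
    then have "u0 = 0" using u by (intro B_nondegenerate) auto
    then show ?thesis using u by simp
  qed
  have \<delta>_1: "\<delta> x \<in> V0" if x: "x \<in> V1" for x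
  proof -
    obtain u0 u1 where u: "u0 \<in> V0" "u1 \<in> V1" "\<delta> x = u0 + u1" using V_cases \<delta>V x V1_V by metis
    have "B u1 y = 0" if y: "y \<in> V" for y
    proof -
      obtain y0 y1 where y: "y0 \<in> V0" "y1 \<in> V1" "y = y0 + y1" using V_cases[OF y] .
      have "B (\<delta> x) y1 = 0" using \<delta>B[of x y1] \<omega>_odd[of x 1 y1] x y by simp
      then show ?thesis using u y by simp
    qed
    then have "u1 = 0" using u by (intro B_nondegenerate) auto
    then show ?thesis using u by simp
  qed
  have \<delta>_grade: "\<delta> x \<in> grade G (a + 1)" if "x \<in> grade G a" for x a
    using \<delta>_0[of x] \<delta>_1[of x] that bit_cases[of a] by auto
  have der: "\<delta> (br x y) = br (\<delta> x) y + smult G (sgn_pow a) (br x (\<delta> y))"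
    if x: "x \<in> grade G a" and y: "y \<in> grade G b" for x y a b
  proof (rule B_eqI)
    have V: "x \<in> V" "y \<in> V" using x y by (auto intro: grade_V)
    then show "\<delta> (br x y) \<in> V" "br (\<delta> x) y + smult G (sgn_pow a) (br x (\<delta> y)) \<in> V"
      by (auto simp: \<delta>V)
    fix c z assume z: "z \<in> grade G c"
    then have zV: "z \<in> V" by (rule grade_V)
    have e1: "\<omega> x (br y z) = B (br (\<delta> x) y) z" using V zV \<delta>B[of x "br y z"] by (simp add: B_invariant \<delta>V)
    have e2: "\<omega> z (br x y) = - sgn_pow (c * (a + b)) * B (\<delta> (br x y)) z"
      using \<omega>_swap[OF z br_grade[OF x y]] \<delta>B V zV by simp
    have e3: "\<omega> y (br z x) = sgn_pow (c * a) * sgn_pow ((b + 1) * a) * B (br x (\<delta> y)) z"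
    proof -
      have "\<omega> y (br z x) = - sgn_pow (c * a) * B (\<delta> y) (br x z)"
        using \<delta>B[of y "br z x"] br_swap[OF z x] V zV by (simp add: \<delta>V)
      also have "B (\<delta> y) (br x z) = B (br (\<delta> y) x) z" using V zV by (simp add: B_invariant \<delta>V)
      also have "br (\<delta> y) x = smult G (- sgn_pow ((b + 1) * a)) (br x (\<delta> y))"
        using br_swap[OF \<delta>_grade[OF y] x] .
      finally show ?thesis using V zV by (simp add: \<delta>V)
    qed
    show "B (\<delta> (br x y)) z = B (br (\<delta> x) y + smult G (sgn_pow a) (br x (\<delta> y))) z"
      using \<omega>_closed[OF x y z] V zV bit_cases[of a] bit_cases[of b] bit_cases[of c]
      unfolding e1 e2 e3 by (auto simp: \<delta>V algebra_simps)
  qed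
  have "superderivation G 1 \<delta>"
    unfolding superderivation_def
  proof (intro conjI allI ballI)
    show "linear_on (smult G) (smult G) V \<delta>" by (simp add: linear_on_def \<delta>_add \<delta>_scale)
    show "\<delta> ` grade G a \<subseteq> grade G (a + 1)" for a
      using \<delta>_grade by (intro image_subsetI)
    fix a x y assume x: "x \<in> grade G a" and "y \<in> V"
    then obtain y0 y1 where y: "y0 \<in> V0" "y1 \<in> V1" "y = y0 + y1" by (elim V_cases)
    have "x \<in> V" using x by (rule grade_V)
    then show "\<delta> (br x y) = br (\<delta> x) y + smult G (sgn_pow (1 * a)) (br x (\<delta> y))"
      using der[OF x y(1)] der[OF x y(2)] y(1,2)
      by (simp add: y(3) \<delta>_add \<delta>V scale_right_distrib algebra_simps)
  qed
  moreover have "bij_betw \<delta> V V"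
    unfolding bij_betw_def
  proof
    show "inj_on \<delta> V"
    proof (rule inj_onI)
      fix x y assume xy: "x \<in> V" "y \<in> V" "\<delta> x = \<delta> y"
      have "\<delta> (x - y) = 0"
        using \<delta>_add[of x "- y"] \<delta>_scale[of y "- 1"] xy by simp
      then have "x - y = 0"
        using \<delta>B[of "x - y"] xy by (intro \<omega>_nondegenerate) auto
      then show "x = y" by simp
    qed
    show "\<delta> ` V = V"
    proof
      show "\<delta> ` V \<subseteq> V" using \<delta>V by auto
      show "V \<subseteq> \<delta> ` V"
      proof
        fix y assume y: "y \<in> V"
        then obtain x where x: "x \<in> V" "\<forall>z\<in>V. \<omega> x z = B y z" using \<omega>_represents[OF linear_B(1)] by blast
        have "\<delta> x = y" using x y grade_V by (intro B_eqI) (auto simp: \<delta>V \<delta>B)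
        then show "y \<in> \<delta> ` V" using x by blast
      qed
    qed
  qed
  ultimately show ?thesis
    unfolding associated_superderivation_def using \<delta>B by auto
qed

end

locale quadratic_symplectic_derivation = quadratic_symplectic G
  for G :: "('k::field_char_0, 'v::ab_group_add) qs_superalgebra" +
  fixes \<delta> :: "'v \<Rightarrow> 'v"
  assumes associated: "associated_superderivation G \<delta>"
begin

lemma linear_\<delta>: "linear_on (smult G) (smult G) V \<delta>"
  using associated unfolding associated_superderivation_def superderivation_def by blast

lemmas \<delta>_linear [simp] =
  linear_onD[OF linear_\<delta>] linear_on_0[OF linear_\<delta> subspace_V]
  linear_on_neg[OF linear_\<delta> subspace_V] linear_on_diff[OF linear_\<delta> subspace_V]

lemma \<delta>_grade: "x \<in> grade G a \<Longrightarrow> \<delta> x \<in> grade G (a + 1)"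
  using associated unfolding associated_superderivation_def superderivation_def by blast

lemma \<delta>_parity [simp]: "x \<in> V0 \<Longrightarrow> \<delta> x \<in> V1" "x \<in> V1 \<Longrightarrow> \<delta> x \<in> V0"
  using \<delta>_grade[of x 0] \<delta>_grade[of x 1] by auto

lemma bij_\<delta>: "bij_betw \<delta> V V"
  using associated unfolding associated_superderivation_def by blast

lemma \<delta>_V [simp]: "x \<in> V \<Longrightarrow> \<delta> x \<in> V"
  using bij_\<delta> by (auto simp: bij_betw_def)

lemma \<delta>_eq_0: "x \<in> V \<Longrightarrow> \<delta> x = 0 \<Longrightarrow> x = 0"
  using bij_\<delta> inj_onD[of \<delta> V x 0] by (simp add: bij_betw_def)

lemma \<omega>_\<delta>: "x \<in> V \<Longrightarrow> y \<in> V \<Longrightarrow> \<omega> x y = B (\<delta> x) y"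
  using associated unfolding associated_superderivation_def by blast

lemma \<delta>_br_homogeneous:
  "x \<in> grade G a \<Longrightarrow> y \<in> V \<Longrightarrow> \<delta> (br x y) = br (\<delta> x) y + smult G (sgn_pow (1 * a)) (br x (\<delta> y))"
  using associated unfolding associated_superderivation_def superderivation_def by blast

lemma \<delta>_br: "x \<in> V \<Longrightarrow> y \<in> V \<Longrightarrow> \<delta> (br x y) = br (\<delta> x) y + br (\<sigma> x) (\<delta> y)"
proof (erule V_cases)
  fix x0 x1 assume "y \<in> V" "x0 \<in> V0" "x1 \<in> V1" "x = x0 + x1"
  then show ?thesis
    using \<delta>_br_homogeneous[of x0 0 y] \<delta>_br_homogeneous[of x1 1 y] by (simp add: \<sigma>_sum)
qed

lemma \<delta>_\<sigma>: "x \<in> V \<Longrightarrow> \<delta> (\<sigma> x) = - \<sigma> (\<delta> x)"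
proof (erule V_cases)
  fix x0 x1 assume *: "x0 \<in> V0" "x1 \<in> V1" "x = x0 + x1"
  then have "\<sigma> (\<delta> x1 + \<delta> x0) = \<delta> x1 - \<delta> x0" by (intro \<sigma>_sum) auto
  then show ?thesis using * by (simp add: \<sigma>_sum add.commute)
qed

lemma \<delta>_skew_homogeneous:
  assumes "x \<in> grade G a" "y \<in> grade G b"
  shows "B (\<delta> x) y = - sgn_pow a * B x (\<delta> y)"
proof -
  have V: "x \<in> V" "y \<in> V" using assms by (auto intro: grade_V)
  have "B (\<delta> x) y = - sgn_pow (a * b) * B (\<delta> y) x" using \<omega>_swap[OF assms] \<omega>_\<delta> V by simp
  also have "B (\<delta> y) x = sgn_pow ((b + 1) * a) * B x (\<delta> y)" using B_swap[OF \<delta>_grade[OF assms(2)] assms(1)] .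
  finally show ?thesis using bit_cases[of a] bit_cases[of b] by auto
qed

lemma \<delta>_skew: "x \<in> V \<Longrightarrow> y \<in> V \<Longrightarrow> B (\<delta> x) y = - B (\<sigma> x) (\<delta> y)"
proof (elim V_cases)
  fix x0 x1 y0 y1 assume *: "x0 \<in> V0" "x1 \<in> V1" "x = x0 + x1" "y0 \<in> V0" "y1 \<in> V1" "y = y0 + y1"
  then show ?thesis
    using \<delta>_skew_homogeneous[of x0 0 y0 0] \<delta>_skew_homogeneous[of x0 0 y1 1]
      \<delta>_skew_homogeneous[of x1 1 y0 0] \<delta>_skew_homogeneous[of x1 1 y1 1] by (simp add: \<sigma>_sum)
qed

text \<open>Skewness of \<open>\<delta>\<close> relates \<open>B(f0, f0)\<close> to \<open>B(f1, f1)\<close>, which is zero because \<open>f1\<close> is odd.\<close>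

lemma isotropic_eigenvector:
  assumes "f0 \<in> V0" "f1 \<in> V1" "\<delta> f0 = smult G lam f1" "\<delta> f1 = smult G lam f0" "lam \<noteq> 0"
  shows "B f0 f0 = 0"
proof -
  have "lam * B f1 f1 = - (lam * B f0 f0)" using \<delta>_skew[of f0 f1] assms by simp
  then show ?thesis using B_odd_self[OF assms(2)] assms(5) by simp
qed

abbreviation "T \<equiv> \<lambda>x. \<delta> (\<delta> x)"

text \<open>The square of the odd superderivation is an even derivation: the two mixed terms cancel because \<open>\<delta>\<close>
  anticommutes with \<open>\<sigma>\<close>.\<close>

lemma T_br: "x \<in> V \<Longrightarrow> y \<in> V \<Longrightarrow> T (br x y) = br (T x) y + br x (T y)"
  by (simp add: \<delta>_br \<delta>_\<sigma>)

lemma T_grade: "x \<in> grade G a \<Longrightarrow> T x \<in> grade G a"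
  using \<delta>_grade[OF \<delta>_grade, of x a] bit_cases[of a] by auto

definition central :: "'v \<Rightarrow> bool" where
  "central z \<longleftrightarrow> z \<in> V \<and> (\<forall>x\<in>V. br x z = 0)"

lemma central_\<delta>: 
  assumes "central z"
  shows "central (\<delta> z)"
proof -
  have "br x (\<delta> z) = 0" if "x \<in> V" for x
    using \<delta>_br[of "\<sigma> x" z] that assms by (simp add: central_def)
  then show ?thesis using assms by (simp add: central_def)
qed

text \<open>For homogeneous \<open>y\<close>, the brackets with \<open>x0\<close> and \<open>x1\<close> have different degrees, so they cannot cancel.\<close>

lemma central_components:
  assumes "x0 \<in> V0" "x1 \<in> V1" "central (x0 + x1)"
  shows "central x0" "central x1"
proof -
  have hom: "br y x0 = 0 \<and> br y x1 = 0" if y: "y \<in> grade G a" for y a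
  proof -
    have "y \<in> V" using y by (rule grade_V)
    then have s: "br y x0 + br y x1 = 0" using assms by (simp add: central_def)
    then have t: "br y x1 + br y x0 = 0" by (simp add: add.commute)
    consider "y \<in> V0" | "y \<in> V1" using y bit_cases[of a] by auto
    then show ?thesis
    proof cases
      case 1
      then show ?thesis using grade_unique[of "br y x0" "br y x1" 0 0] s assms(1,2) by simp
    next
      case 2
      then show ?thesis using grade_unique[of "br y x1" "br y x0" 0 0] t assms(1,2) by simp
    qed
  qed
  have "br y x0 = 0 \<and> br y x1 = 0" if y: "y \<in> V" for y
  proof -
    obtain y0 y1 where "y0 \<in> V0" "y1 \<in> V1" "y = y0 + y1" using V_cases[OF y] .
    then show ?thesis using hom[of y0 0] hom[of y1 1] assms(1,2) by simp
  qed
  then show "central x0" "central x1" using assms(1,2) by (auto simp: central_def)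
qed

end

locale quadratic_symplectic_closed = quadratic_symplectic_derivation G \<delta>
  for G :: "('k::{alg_closed_field, field_char_0}, 'v::ab_group_add) qs_superalgebra" and \<delta>
begin

sublocale op: operator_on_subspace "smult G" V T
  by unfold_locales (auto simp: subspace_V linear_on_def)

sublocale gop: operator_on_subspace "smult G" "grade G a" T for a
  using T_grade
  by unfold_locales (auto simp: subspace_grade linear_on_def grade_V)

abbreviation "E \<equiv> generalized_eigenspace (smult G) V T"

lemma E_grade: "generalized_eigenspace (smult G) (grade G a) T \<mu> = E \<mu> \<inter> grade G a"
  using grade_V by (auto simp: generalized_eigenspace_def)

text \<open>The shifted operators satisfy \<open>(T - \<mu> - \<nu>) [x, y] = [(T - \<mu>) x, y] + [x, (T - \<nu>) y]\<close>, so the sum of the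
  nilpotency orders of the two arguments decreases.\<close>

lemma E_bracket:
  assumes "x \<in> E \<mu>" "y \<in> E \<nu>"
  shows "br x y \<in> E (\<mu> + \<nu>)"
proof -
  let ?S = "shift_op (smult G) T"
  have "br x y \<in> E (\<mu> + \<nu>)"
    if "x \<in> V" "y \<in> V" "(?S \<mu> ^^ m) x = 0" "(?S \<nu> ^^ l) y = 0" for m l x y
    using that
  proof (induction "m + l" arbitrary: m l x y rule: less_induct)
    case less
    show ?case
    proof (cases "m = 0 \<or> l = 0")
      case True
      then have "br x y = 0" using less.prems by auto
      then show ?thesis using op.subspace_E subspace_0 by simp
    next
      case False
      then obtain m' l' where ml: "m = Suc m'" "l = Suc l'" by (metis not0_implies_Suc)
      have "br (?S \<mu> x) y \<in> E (\<mu> + \<nu>)"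
        using less.prems ml op.S_in
        by (intro less.hyps[of m' l]) (auto simp: funpow_Suc_right simp del: funpow.simps)
      moreover have "br x (?S \<nu> y) \<in> E (\<mu> + \<nu>)"
        using less.prems ml op.S_in
        by (intro less.hyps[of m l']) (auto simp: funpow_Suc_right simp del: funpow.simps)
      moreover have "?S (\<mu> + \<nu>) (br x y) = br (?S \<mu> x) y + br x (?S \<nu> y)"
        using less.prems(1,2) by (simp add: shift_op_def T_br scale_left_distrib)
      ultimately have "?S (\<mu> + \<nu>) (br x y) \<in> E (\<mu> + \<nu>)"
        using op.subspace_E by (simp add: subspace_add)
      then show ?thesis using op.E_S[of "br x y" "\<mu> + \<nu>"] less.prems(1,2) by simp
    qed
  qed
  then show ?thesis using assms by (auto simp: generalized_eigenspace_def)
qed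

text \<open>For \<open>\<mu> \<noteq> 0\<close> the values \<open>\<nu> + k \<mu>\<close> are distinct in characteristic zero, so at most as many steps as
  there are eigenvalues lead from \<open>E \<nu>\<close> to a trivial generalized eigenspace. For \<open>\<mu> = 0\<close> the vector
  itself is zero, since \<open>\<delta>\<close> is injective.\<close>

lemma ad_nilpotent:
  assumes "x \<in> E \<mu>"
  shows "\<exists>n. \<forall>v\<in>V. (br x ^^ n) v = 0"
proof (cases "\<mu> = 0")
  case True
  have xV: "x \<in> V" using assms op.E_subset by auto
  obtain n where "(shift_op (smult G) T 0 ^^ n) x = 0"
    using assms True by (auto simp: generalized_eigenspace_def)
  moreover have "v = 0" if "v \<in> V" "(shift_op (smult G) T 0 ^^ n) v = 0" for v
    using that
  proof (induction n)
    case (Suc n)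
    let ?u = "(shift_op (smult G) T 0 ^^ n) v"
    have "?u \<in> V" using op.S_power_in Suc.prems by simp
    moreover have "shift_op (smult G) T 0 ?u = 0" using Suc.prems(2) by simp
    then have "T ?u = 0" unfolding shift_op_def[of _ _ _ ?u] by simp
    ultimately have "?u = 0" using \<delta>_eq_0 \<delta>_V by blast
    then show ?case using Suc by simp
  qed simp
  ultimately have "x = 0" using xV by blast
  then show ?thesis by (intro exI[of _ 1]) simp
next
  case False
  have xV: "x \<in> V" using assms op.E_subset by auto
  obtain A where A: "finite A" "V \<subseteq> span A" using finite_spanning .
  define R where "R = {\<nu>. E \<nu> \<noteq> {0}}"
  have R: "finite R" unfolding R_def by (rule op.finite_spectrum[OF A])
  have step: "(br x ^^ k) v \<in> E (\<nu> + of_nat k * \<mu>)" if "v \<in> E \<nu>" for v \<nu> k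
  proof (induction k)
    case (Suc k)
    then show ?case using E_bracket[OF assms Suc] by (simp add: algebra_simps)
  qed (use that in simp)
  have stab: "br x ` V \<subseteq> V" using xV by auto
  have zero: "(br x ^^ k) 0 = 0" for k using xV by (induction k) auto
  have killed: "(br x ^^ card R) v = 0" if v: "v \<in> E \<nu>" for v \<nu>
  proof -
    have "\<exists>k\<le>card R. \<nu> + of_nat k * \<mu> \<notin> R"
    proof (rule ccontr)
      assume "\<not> ?thesis"
      then have "(\<lambda>k. \<nu> + of_nat k * \<mu>) ` {..card R} \<subseteq> R" by auto
      moreover have "inj_on (\<lambda>k. \<nu> + of_nat k * \<mu>) {..card R}"
        using False by (auto simp: inj_on_def)
      ultimately have "card {..card R} \<le> card R" using R card_inj_on_le by blast
      then show False by simp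
    qed
    then obtain k where k: "k \<le> card R" "E (\<nu> + of_nat k * \<mu>) = {0}" by (auto simp: R_def)
    then have "(br x ^^ k) v = 0" using step[OF v, of k] by simp
    then show ?thesis using funpow_add[of "card R - k" k "br x"] k(1) zero by simp
  qed
  have lin: "linear_on (smult G) (smult G) V (br x ^^ card R)"
    using linear_on_funpow[OF linear_br(1)[OF xV] stab] .
  have "linear_on (smult G) (smult G) V (\<lambda>_. 0)" by (simp add: linear_on_def)
  then have "(br x ^^ card R) v = 0" if "v \<in> V" for v
    using linear_on_eq_on_span[OF lin _ subspace_V, of "\<lambda>_. 0" "\<Union>\<mu>. E \<mu>" v] killed
      op.span_generalized_eigenspaces[OF A] op.E_subset that by blast
  then show ?thesis by blast
qed

text \<open>Only vectors that are also homogeneous for the parity are used: for them the Jacobi identity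
  gives \<open>ad [x, y] = f g + \<gamma> g f\<close> with \<open>f = ad x\<close>, \<open>g = ad y\<close> and a sign \<open>\<gamma>\<close>.\<close>

definition ads :: "('v \<Rightarrow> 'v) set" where
  "ads = {br x | x \<mu> a. x \<in> E \<mu> \<and> x \<in> grade G a}"

lemma weakly_closed_ads: "weakly_closed (smult G) V ads"
  unfolding weakly_closed_def
proof (intro conjI ballI)
  fix f assume "f \<in> ads"
  then obtain x a where "f = br x" "x \<in> grade G a" by (auto simp: ads_def)
  then have "f = br x" "x \<in> V" by (auto intro: grade_V)
  then show "linear_on (smult G) (smult G) V f" "f ` V \<subseteq> V" using linear_br(1) by auto
next
  fix f g assume "f \<in> ads" "g \<in> ads"
  then obtain x y a b \<mu> \<nu> where f: "f = br x" "x \<in> E \<mu>" "x \<in> grade G a"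
    and g: "g = br y" "y \<in> E \<nu>" "y \<in> grade G b"
    by (auto simp: ads_def)
  have V: "x \<in> V" "y \<in> V" using f g by (auto intro: grade_V)
  have "br (br x y) \<in> ads"
    using E_bracket[OF f(2) g(2)] br_grade[OF f(3) g(3)] unfolding ads_def by blast
  moreover have "br (br x y) v = f (g v) + smult G (- sgn_pow (a * b)) (g (f v))" if "v \<in> V" for v
    using jacobi_even[of x y v] jacobi_odd[of x y v] f g V that bit_cases[of a] bit_cases[of b] by auto
  ultimately show "\<exists>h\<in>ads. \<exists>\<gamma>. \<forall>v\<in>V. h v = f (g v) + smult G \<gamma> (g (f v))" by blast
qed

text \<open>A common null vector of all \<open>ad x\<close> with \<open>x\<close> a homogeneous generalized eigenvector is central, because
  each graded component is spanned by such \<open>x\<close>.\<close>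

theorem nonzero_central_element:
  assumes "V \<noteq> {0}"
  obtains z where "central z" "z \<noteq> 0"
proof -
  obtain A where A: "finite A" "V \<subseteq> span A" using finite_spanning .
  have stable: "w ` V \<subseteq> V" if "w \<in> ads" for w
    using weakly_closed_ads that by (simp add: weakly_closed_def)
  have nil: "\<exists>n. \<forall>v\<in>V. (w ^^ n) v = 0" if "w \<in> ads" for w
    using that ad_nilpotent by (auto simp: ads_def)
  have w0: "w ` {0} \<subseteq> {0}" if "w \<in> ads" for w
    using that grade_V by (auto simp: ads_def)
  have nb: "nil_between {0} V ads"
  proof (rule weakly_closed_nil[OF A subspace_V weakly_closed_ads])
    show "\<exists>n. \<forall>v\<in>V. (w ^^ n) v = 0" if "w \<in> ads" for w using nil[OF that] .
    show "w ` {0} \<subseteq> {0}" if "w \<in> ads" for w using w0[OF that] .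
    show "w ` V \<subseteq> V" if "w \<in> ads" for w using stable[OF that] .
  qed (simp_all add: subspace_V)
  have "\<not> V \<subseteq> {0}" using assms V_closed(1) by blast
  from nil_between_common_null_vector[OF nb this stable]
  obtain v where v: "v \<in> V" "v \<notin> {0}" "\<And>w. w \<in> ads \<Longrightarrow> w v \<in> {0}" by metis
  have hom: "br x v = 0" if x: "x \<in> grade G a" for x a
  proof -
    let ?X = "\<Union>\<mu>. generalized_eigenspace (smult G) (grade G a) T \<mu>"
    have A': "grade G a \<subseteq> span A" using A(2) grade_V by auto
    have lin0: "linear_on (smult G) (smult G) V (\<lambda>_. 0)" by (simp add: linear_on_def)
    have "?X \<subseteq> V" using grade_V by (auto simp: E_grade)
    moreover have "br x v = 0" if "x \<in> ?X" for x
    proof -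
      have "br x \<in> ads" using that by (auto simp: ads_def E_grade)
      then show ?thesis using v(3) by blast
    qed
    moreover have "x \<in> span ?X" using gop.span_generalized_eigenspaces[OF A(1) A'] x by blast
    ultimately show ?thesis
      using linear_on_eq_on_span[OF linear_br(2)[OF v(1)] lin0 subspace_V] by blast
  qed
  have "br x v = 0" if x: "x \<in> V" for x
  proof -
    obtain x0 x1 where "x0 \<in> V0" "x1 \<in> V1" "x = x0 + x1" using V_cases[OF x] .
    then show ?thesis using hom[of x0 0] hom[of x1 1] v(1) by simp
  qed
  then show thesis using that[of v] v(1,2) by (simp add: central_def)
qed

text \<open>An odd central element is moved to an even one by \<open>\<delta>\<close>, so the even part of the center is nonzero; it
  is stable under \<open>\<delta>\<^sup>2\<close>, and eigenvalues have square roots in an algebraically closed field.\<close>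

theorem central_eigenvector:
  assumes "V \<noteq> {0}"
  obtains e lam where "e \<in> V0" "e \<noteq> 0" "central e" "lam \<noteq> 0" "\<delta> (\<delta> e) = smult G (lam * lam) e"
proof -
  obtain z where z: "central z" "z \<noteq> 0" using nonzero_central_element[OF assms] .
  then obtain z0 z1 where zz: "z0 \<in> V0" "z1 \<in> V1" "z = z0 + z1" by (auto simp: central_def elim: V_cases)
  have c: "central z0" "central z1" using central_components[OF zz(1,2)] z(1) zz(3) by auto
  define Z where "Z = {z \<in> V0. central z}"
  have "\<exists>x\<in>Z. x \<noteq> 0"
  proof (cases "z0 = 0")
    case True
    then have "\<delta> z1 \<noteq> 0" using \<delta>_eq_0[of z1] zz z(2) by auto
    then show ?thesis using zz(2) central_\<delta>[OF c(2)] by (intro bexI[of _ "\<delta> z1"]) (auto simp: Z_def)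
  qed (use zz c in \<open>auto simp: Z_def\<close>)
  then have Z0: "Z \<noteq> {0}" by auto
  have ZV: "Z \<subseteq> V" by (auto simp: Z_def)
  have sub: "subspace Z" by (rule subspaceI) (auto simp: Z_def central_def)
  interpret Z: operator_on_subspace "smult G" Z T
    using sub ZV central_\<delta>[OF central_\<delta>]
    by unfold_locales (auto simp: linear_on_def Z_def)
  obtain A where A: "finite A" "V \<subseteq> span A" using finite_spanning .
  obtain e \<mu> where e: "e \<in> Z" "e \<noteq> 0" "T e = smult G \<mu> e"
    using Z.eigenvector_exists[OF A(1) _ Z0] A(2) ZV by blast
  have "\<mu> \<noteq> 0" using e \<delta>_eq_0[of e] \<delta>_eq_0[of "\<delta> e"] ZV by auto
  obtain lam where l: "lam ^ 2 = \<mu>" using nth_root_exists[of 2 \<mu>] by auto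
  then have "lam \<noteq> 0" using \<open>\<mu> \<noteq> 0\<close> by auto
  then show thesis using that[of e lam] e l by (auto simp: Z_def power2_eq_square)
qed

end

section \<open>Reduction by a central isotropic plane\<close>

text \<open>The vectors \<open>f0\<close>, \<open>f1\<close> play the role of \<open>e\<^sub>0\<^sup>*\<close>, \<open>e\<^sub>1\<^sup>*\<close> in the double extension that is to be
  recognised.\<close>

locale hyperbolic_frame = quadratic_symplectic_derivation G \<delta>
  for G :: "('k::field_char_0, 'v::ab_group_add) qs_superalgebra" and \<delta> +
  fixes f0 f1 e0 e1 :: 'v and lam :: 'k
  assumes parities [simp]: "f0 \<in> V0" "f1 \<in> V1" "e0 \<in> V0" "e1 \<in> V1"
    and central_f: "central f0" "central f1"
    and lam: "lam \<noteq> 0"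
    and \<delta>_f [simp]: "\<delta> f0 = smult G lam f1" "\<delta> f1 = smult G lam f0"
    and B_fe [simp]: "B f0 e0 = 1" "B f1 e1 = 1" and B_ee [simp]: "B e0 e0 = 0"
begin

lemma B_ff [simp]: "B f0 f0 = 0" "B f1 f1 = 0"
  using isotropic_eigenvector[of f0 f1 lam] lam by (simp_all add: B_odd_self)

lemma B_ef [simp]: "B e0 f0 = 1" "B e1 f1 = - 1" "B e1 e1 = 0"
  using B_even[of f0 e0] B_odd[of f1 e1] by (simp_all add: B_odd_self)

lemma br_f [simp]: "x \<in> V \<Longrightarrow> br x f0 = 0" "x \<in> V \<Longrightarrow> br x f1 = 0"
    "x \<in> V \<Longrightarrow> br f0 x = 0" "x \<in> V \<Longrightarrow> br f1 x = 0"
proof -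
  show l: "br x f0 = 0" "br x f1 = 0" if "x \<in> V" for x
    using central_f that by (auto simp: central_def)
  show "br f0 x = 0" if "x \<in> V" using br_even[of f0 x] l that by simp
  show "br f1 x = 0" if "x \<in> V" using br_odd[of f1 "\<sigma> x"] l that by simp
qed

text \<open>The orthogonal projection that kills the frame. The coefficient of a frame vector is the pairing
  with the dual one; the order of the arguments of \<open>B\<close> matters for the odd pair, where
  \<open>B f1 e1 = 1\<close> and \<open>B e1 f1 = - 1\<close>.\<close>

definition proj :: "'v \<Rightarrow> 'v" where
  "proj x = x - smult G (B x e0) f0 - smult G (B x e1) f1 - smult G (B f0 x) e0 - smult G (B f1 x) e1"

text \<open>The orthogonal of the central plane. It is an ideal containing all brackets, and on it the
  projection only changes elements by central ones; this is why brackets and \<open>\<delta>\<close> do not notice an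
  inner projection.\<close>

definition J :: "'v set" where
  "J = {x \<in> V. B f0 x = 0 \<and> B f1 x = 0}"

definition hgrade :: "bit \<Rightarrow> 'v set" where
  "hgrade a = {x \<in> grade G a. B f0 x = 0 \<and> B f1 x = 0 \<and> B x e0 = 0 \<and> B x e1 = 0}"

text \<open>The subquotient \<open>J\<close> modulo the central plane, realised on the complement of the frame inside the
  same ambient type.\<close>

definition H :: "('k, 'v) qs_superalgebra" where
  "H = \<lparr> smult = smult G, grade = hgrade, bracket = (\<lambda>x y. proj (br x y)), qform = B, sform = \<omega> \<rparr>"

lemma H_sel [simp]: "smult H = smult G" "grade H = hgrade" "bracket H x y = proj (br x y)"
    "qform H = B" "sform H = \<omega>"
  by (simp_all add: H_def)

abbreviation "h \<equiv> carrier H"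

lemma h_iff: "x \<in> h \<longleftrightarrow> x \<in> V \<and> B f0 x = 0 \<and> B f1 x = 0 \<and> B x e0 = 0 \<and> B x e1 = 0"
proof
  assume "x \<in> h"
  then obtain x0 x1 where "x0 \<in> hgrade 0" "x1 \<in> hgrade 1" "x = x0 + x1" by (auto simp: carrier_def)
  then show "x \<in> V \<and> B f0 x = 0 \<and> B f1 x = 0 \<and> B x e0 = 0 \<and> B x e1 = 0" by (simp add: hgrade_def)
next
  assume x: "x \<in> V \<and> B f0 x = 0 \<and> B f1 x = 0 \<and> B x e0 = 0 \<and> B x e1 = 0"
  then obtain x0 x1 where d: "x0 \<in> V0" "x1 \<in> V1" "x = x0 + x1" using V_cases by metis
  then have "x0 \<in> hgrade 0" "x1 \<in> hgrade 1" using x by (simp_all add: hgrade_def)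
  then show "x \<in> h" using d(3) by (auto simp: carrier_def)
qed

lemma hI: "x \<in> V \<Longrightarrow> B f0 x = 0 \<Longrightarrow> B f1 x = 0 \<Longrightarrow> B x e0 = 0 \<Longrightarrow> B x e1 = 0 \<Longrightarrow> x \<in> h"
  by (simp add: h_iff)

lemma JI: "x \<in> V \<Longrightarrow> B f0 x = 0 \<Longrightarrow> B f1 x = 0 \<Longrightarrow> x \<in> J"
  by (simp add: J_def)

lemma h_V: "x \<in> h \<Longrightarrow> x \<in> V" and h_J: "x \<in> h \<Longrightarrow> x \<in> J" and J_V: "x \<in> J \<Longrightarrow> x \<in> V"
  by (simp_all add: h_iff J_def)

lemma J_orthogonal [simp]: "x \<in> J \<Longrightarrow> B f0 x = 0" "x \<in> J \<Longrightarrow> B f1 x = 0"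
    "x \<in> J \<Longrightarrow> B x f0 = 0" "x \<in> J \<Longrightarrow> B x f1 = 0"
  using B_even[of f0 x] B_odd[of f1 x] by (simp_all add: J_def)

lemma h_orthogonal [simp]: "x \<in> h \<Longrightarrow> B x e0 = 0" "x \<in> h \<Longrightarrow> B x e1 = 0"
    "x \<in> h \<Longrightarrow> B e0 x = 0" "x \<in> h \<Longrightarrow> B e1 x = 0"
  using B_even[of e0 x] B_odd[of e1 x] by (simp_all add: h_iff)

declare h_V [simp] h_J [simp] J_V [simp]

lemma hgrade_h: "x \<in> hgrade a \<Longrightarrow> x \<in> h"
  by (auto simp: hgrade_def intro: hI grade_V)

lemma hgrade_grade: "x \<in> hgrade a \<Longrightarrow> x \<in> grade G a"
  by (simp add: hgrade_def)

lemma subspace_h: "subspace h"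
  by (rule subspaceI) (auto intro!: hI)

lemma subspace_hgrade: "subspace (hgrade a)"
  by (rule subspaceI) (auto simp: hgrade_def grade_V)

lemma h_closed [simp]:
  "0 \<in> h" "x \<in> h \<Longrightarrow> y \<in> h \<Longrightarrow> x + y \<in> h" "x \<in> h \<Longrightarrow> y \<in> h \<Longrightarrow> x - y \<in> h"
  "x \<in> h \<Longrightarrow> - x \<in> h" "x \<in> h \<Longrightarrow> smult G c x \<in> h"
  using subspace_h by (auto simp: subspace_0 subspace_add subspace_diff subspace_neg subspace_scale)

lemma proj_V [simp]: "x \<in> V \<Longrightarrow> proj x \<in> V"
  by (simp add: proj_def)

lemma proj_h [simp]: "x \<in> V \<Longrightarrow> proj x \<in> h"
  using B_even[of f0 x] B_odd[of f1 x] B_even[of e0 x] B_odd[of e1 x] by (intro hI) (simp_all add: proj_def)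

lemma proj_grade: "x \<in> grade G a \<Longrightarrow> proj x \<in> hgrade a"
proof -
  assume x: "x \<in> grade G a"
  then have "proj x \<in> grade G a" using bit_cases[of a] by (auto simp: proj_def)
  moreover have "proj x \<in> h" using x by (auto intro: proj_h grade_V)
  ultimately show ?thesis by (simp add: hgrade_def)
qed

lemma proj_id [simp]: "x \<in> h \<Longrightarrow> proj x = x"
  by (simp add: proj_def)

lemma proj_add: "x \<in> V \<Longrightarrow> y \<in> V \<Longrightarrow> proj (x + y) = proj x + proj y"
  by (simp add: proj_def scale_left_distrib algebra_simps)

lemma proj_scale: "x \<in> V \<Longrightarrow> proj (smult G c x) = smult G c (proj x)"
  by (simp add: proj_def scale_right_diff_distrib)

lemma linear_proj: "linear_on (smult G) (smult G) V proj"
  by (simp add: linear_on_def proj_add proj_scale)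

lemmas proj_linear [simp] = proj_add proj_scale
  linear_on_0[OF linear_proj subspace_V]
  linear_on_neg[OF linear_proj subspace_V] linear_on_diff[OF linear_proj subspace_V]

lemma proj_f [simp]: "proj f0 = 0" "proj f1 = 0" "proj e0 = 0" "proj e1 = 0"
  by (simp_all add: proj_def)

lemma decomposition:
  "x = smult G (B x e0) f0 + smult G (B x e1) f1 + proj x + smult G (B f0 x) e0 + smult G (B f1 x) e1"
  by (simp add: proj_def)

lemma decomposition_J:
  "x \<in> J \<Longrightarrow> x = smult G (B x e0) f0 + smult G (B x e1) f1 + proj x"
  by (simp add: proj_def)

lemma B_proj [simp]: 
  assumes "x \<in> V" "y \<in> h"
  shows "B (proj x) y = B x y" "B y (proj x) = B y x"
  using assms by (simp_all add: proj_def)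

lemma br_J [simp]: "x \<in> V \<Longrightarrow> y \<in> V \<Longrightarrow> br x y \<in> J"
  using B_invariant[of f0 x y] B_invariant[of f1 x y] by (intro JI) simp_all

lemma \<delta>_J [simp]: "x \<in> J \<Longrightarrow> \<delta> x \<in> J"
  using \<delta>_skew[of f0 x] \<delta>_skew[of f1 x] by (intro JI) simp_all

lemma br_proj [simp]:
  assumes "u \<in> J" "z \<in> V"
  shows "br z (proj u) = br z u" "br (proj u) z = br u z"
  using assms by (simp_all add: proj_def)

lemma \<delta>_proj [simp]: "u \<in> J \<Longrightarrow> proj (\<delta> (proj u)) = proj (\<delta> u)"
  by (simp add: proj_def[of u])

lemma B_J_proj:
  assumes "u \<in> J" "v \<in> J"
  shows "B u (proj v) = B u v"
  using assms by (simp add: proj_def)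

lemma finite_dim_H: "finite_dim_superspace H"
  unfolding finite_dim_superspace_def
proof (intro conjI allI)
  show "vector_space (smult H)" by (simp add: vector_space_axioms)
  show "module.subspace (smult H) (grade H a)" for a using subspace_hgrade by simp
  show "grade H 0 \<inter> grade H 1 = {0}"
    using grade_Int subspace_0[OF subspace_hgrade] by (auto dest: hgrade_grade)
  obtain A where A: "finite A" "V \<subseteq> span A" using finite_spanning .
  then have "h \<subseteq> span A" using h_V by blast
  then show "\<exists>S. finite S \<and> h = module.span (smult H) S"
    using finite_spanning_subspace[OF A(1) _ subspace_h] by simp
qed

lemma lie_H: "lie_superalgebra H"
  unfolding lie_superalgebra_def
proof (intro conjI allI ballI)
  show "finite_dim_superspace H" by (rule finite_dim_H)
  show "bilinear_on (smult H) (smult H) h (bracket H)"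
    by (simp add: bilinear_on_def linear_on_def)
  fix a b x y assume xy: "x \<in> grade H a" "y \<in> grade H b"
  have g: "x \<in> grade G a" "y \<in> grade G b" and hh: "x \<in> h" "y \<in> h"
    using xy by (auto intro: hgrade_grade hgrade_h)
  show "bracket H x y \<in> grade H (a + b)"
    unfolding H_sel using proj_grade[OF br_grade[OF g]] .
  show "bracket H x y = smult H (- sgn_pow (a * b)) (bracket H y x)"
    unfolding H_sel using br_swap[OF g] hh by simp
  fix c z assume z: "z \<in> grade H c"
  have gz: "z \<in> grade G c" and hz: "z \<in> h" using z by (auto intro: hgrade_grade hgrade_h)
  have "proj (smult G (sgn_pow (c * a)) (br x (br y z)) + smult G (sgn_pow (a * b)) (br y (br z x)) +
        smult G (sgn_pow (b * c)) (br z (br x y))) = 0"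
    unfolding jacobi[OF g gz] by simp
  then show "smult H (sgn_pow (c * a)) (bracket H x (bracket H y z)) +
       smult H (sgn_pow (a * b)) (bracket H y (bracket H z x)) +
       smult H (sgn_pow (b * c)) (bracket H z (bracket H x y)) = 0"
    unfolding H_sel using hh hz by simp
qed

lemma nondegenerate_h:
  assumes "x \<in> h" "\<And>y. y \<in> h \<Longrightarrow> B x y = 0"
  shows "x = 0"
proof (rule B_nondegenerate)
  fix y assume y: "y \<in> V"
  have "B x (proj y) = 0" using assms y by (metis proj_h)
  then show "B x y = 0" using assms(1) y by simp
qed (use assms in simp)

lemma scalar_product_H: "even_invariant_scalar_product H B"
  unfolding even_invariant_scalar_product_def
proof (intro conjI)
  show "bilinear_form H B"
    by (simp add: bilinear_form_def bilinear_on_def linear_on_def)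
  show "even_form H B"
    using scalar_product_G unfolding even_invariant_scalar_product_def even_form_def H_sel by (meson hgrade_grade)
  show "supersymmetric H B"
    using B_swap unfolding supersymmetric_def H_sel by (meson hgrade_grade)
  show "invariant_form H B" by (simp add: invariant_form_def B_invariant)
  have "y = 0" if "y \<in> h" "\<forall>x\<in>h. B x y = 0" for y
  proof (rule nondegenerate_h[OF that(1)])
    fix x assume x: "x \<in> h"
    have "\<sigma> x \<in> h"
      using x B_\<sigma>[of x e0] B_\<sigma>[of x e1] B_\<sigma>[of f0 x] B_\<sigma>[of f1 x] by (intro hI) simp_all
    then have "B (\<sigma> x) y = 0" "B x y = 0" using that x by auto
    obtain x0 x1 where d: "x0 \<in> V0" "x1 \<in> V1" "x = x0 + x1" using V_cases x h_V by metis
    have yV: "y \<in> V" using that by simp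
    have "B x0 y + B x1 y = 0" "B x0 y - B x1 y = 0"
      using \<open>B (\<sigma> x) y = 0\<close> \<open>B x y = 0\<close> d yV by (simp_all add: \<sigma>_sum)
    then have "B x1 y + B x1 y = 0" "B x0 y = B x1 y" by auto
    then have "2 * B x1 y = 0" by (simp only: mult_2)
    then have "B x1 y = 0" "B x0 y = 0" using \<open>B x0 y = B x1 y\<close> by simp_all
    then show "B y x = 0" using d yV B_even[of x0 y] B_odd[of x1 y] by simp
  qed
  then show "nondegenerate H B"
    unfolding nondegenerate_def using nondegenerate_h by blast
qed

definition \<delta>h :: "'v \<Rightarrow> 'v" where "\<delta>h x = proj (\<delta> x)"

lemma \<omega>_\<delta>h: "x \<in> h \<Longrightarrow> y \<in> h \<Longrightarrow> \<omega> x y = B (\<delta>h x) y"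
  by (simp add: \<delta>h_def \<omega>_\<delta>)

text \<open>If \<open>\<delta> x\<close> lies in the central plane then so does \<open>x\<close>, because \<open>\<delta>\<close> permutes that plane.\<close>

lemma \<delta>h_inj: 
  assumes "x \<in> h" "\<delta>h x = 0"
  shows "x = 0"
proof -
  have "\<delta> x = smult G (B (\<delta> x) e0) f0 + smult G (B (\<delta> x) e1) f1"
    using decomposition_J[of "\<delta> x"] assms by (simp add: \<delta>h_def)
  moreover define w where "w = smult G (B (\<delta> x) e0 / lam) f1 + smult G (B (\<delta> x) e1 / lam) f0"
  ultimately have "\<delta> (x - w) = 0" using assms(1) lam by simp
  moreover have "x - w \<in> V" using assms(1) by (simp add: w_def)
  ultimately have "x - w = 0" by (rule \<delta>_eq_0[rotated])
  then have "proj x = proj w" by simp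
  also have "proj w = 0" by (simp add: w_def)
  finally show ?thesis using assms(1) by simp
qed

text \<open>The preimage under \<open>\<delta>\<close> of an element of \<open>h\<close> lies in \<open>J\<close>, because \<open>\<delta>\<close> maps the central plane onto
  itself and is skew.\<close>

lemma \<delta>h_surj:
  assumes "y \<in> h"
  shows "\<exists>x\<in>h. \<delta>h x = y"
proof -
  obtain x where x: "x \<in> V" "\<delta> x = y" using bij_\<delta> assms by (metis bij_betw_imp_surj_on h_V imageE)
  have "lam * B f1 x = 0" using \<delta>_skew[of f0 x] x assms by simp
  moreover have "lam * B f0 x = 0" using \<delta>_skew[of f1 x] x assms by simp
  ultimately have "x \<in> J" using lam x by (intro JI) simp_all
  then have "\<delta>h (proj x) = y" using x assms by (simp add: \<delta>h_def)
  then show ?thesis using x(1) proj_h by blast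
qed

lemma symplectic_H: "odd_symplectic_form H \<omega>"
  unfolding odd_symplectic_form_def
proof (intro conjI allI ballI)
  show "bilinear_form H \<omega>"
    by (simp add: bilinear_form_def bilinear_on_def linear_on_def \<omega>_\<delta>)
  show "odd_form H \<omega>" unfolding odd_form_def H_sel using \<omega>_odd by (meson hgrade_grade)
  show "skew_supersymmetric_form H \<omega>"
    unfolding skew_supersymmetric_form_def H_sel using \<omega>_swap by (meson hgrade_grade)
  have l: "x = 0" if "x \<in> h" "\<forall>y\<in>h. \<omega> x y = 0" for x
  proof (rule \<delta>h_inj[OF that(1)], rule nondegenerate_h)
    show "\<delta>h x \<in> h" using that by (simp add: \<delta>h_def)
    show "B (\<delta>h x) y = 0" if "y \<in> h" for y using \<omega>_\<delta>h \<open>x \<in> h\<close> \<open>\<forall>y\<in>h. \<omega> x y = 0\<close> that by auto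
  qed
  have "y = 0" if y: "y \<in> h" "\<forall>x\<in>h. \<omega> x y = 0" for y
  proof (rule nondegenerate_h[OF y(1)])
    have nd: "\<forall>y\<in>h. (\<forall>x\<in>h. B x y = 0) \<longrightarrow> y = 0"
      using scalar_product_H unfolding even_invariant_scalar_product_def nondegenerate_def by blast
    have "\<forall>x\<in>h. B x y = 0" using y \<delta>h_surj \<omega>_\<delta>h by metis
    then have "y = 0" using nd y(1) by blast
    then show "B y x = 0" if "x \<in> h" for x using that by simp
  qed
  then show "nondegenerate H \<omega>" unfolding nondegenerate_def using l by blast
  fix a b c x y z
  assume xyz: "x \<in> grade H a" "y \<in> grade H b" "z \<in> grade H c"
  have g: "x \<in> grade G a" "y \<in> grade G b" "z \<in> grade G c" and hh: "x \<in> h" "y \<in> h" "z \<in> h"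
    using xyz by (auto intro: hgrade_grade hgrade_h)
  have "\<omega> u (proj v) = \<omega> u v" if "u \<in> h" "v \<in> J" for u v
    using that B_J_proj[of "\<delta> u" v] by (simp add: \<omega>_\<delta>)
  then show "sgn_pow (c * a) * \<omega> x (bracket H y z) + sgn_pow (a * b) * \<omega> y (bracket H z x) +
        sgn_pow (b * c) * \<omega> z (bracket H x y) = 0"
    using \<omega>_closed[OF g] hh by simp
qed

theorem eqos_H: "even_quadratic_odd_symplectic H"
  unfolding even_quadratic_odd_symplectic_def using lie_H scalar_product_H symplectic_H by simp

end

section \<open>The extension data and the isometry\<close>

context hyperbolic_frame
begin

text \<open>The data of the double extension. In the notation of its definition, \<open>D0\<close> and \<open>D1\<close> are \<open>D\<close> and its
  odd companion, and \<open>a0\<close>, \<open>a1\<close> are \<open>x\<^sub>0\<close>, \<open>x\<^sub>1\<close>.\<close>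

definition D0 :: "'v \<Rightarrow> 'v" where "D0 x = proj (br e0 x)"
definition D1 :: "'v \<Rightarrow> 'v" where "D1 x = proj (br e1 x)"
definition a0 :: 'v where "a0 = proj (br e1 e1)"
definition a1 :: 'v where "a1 = proj (br e0 e1)"
definition c0 :: 'v where "c0 = proj (\<delta> e1)"
definition c1 :: 'v where "c1 = proj (\<delta> e0)"
definition k :: 'k where "k = B (br e1 e1) e0"
definition \<alpha> :: 'k where "\<alpha> = B (\<delta> e0) e1"

lemma data_hgrade: "a0 \<in> hgrade 0" "a1 \<in> hgrade 1" "c0 \<in> hgrade 0" "c1 \<in> hgrade 1"
  unfolding a0_def a1_def c0_def c1_def by (simp_all add: proj_grade)

lemma data_h [simp]: "a0 \<in> h" "a1 \<in> h" "c0 \<in> h" "c1 \<in> h"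
  using data_hgrade hgrade_h by blast+

lemma data_grade [simp]: "a0 \<in> V0" "a1 \<in> V1" "c0 \<in> V0" "c1 \<in> V1"
  using data_hgrade hgrade_grade by blast+

lemma D_h [simp]: "x \<in> V \<Longrightarrow> D0 x \<in> h" "x \<in> V \<Longrightarrow> D1 x \<in> h" "x \<in> V \<Longrightarrow> \<delta>h x \<in> h"
  by (simp_all add: D0_def D1_def \<delta>h_def)

lemma \<sigma>_grade: "x \<in> grade G a \<Longrightarrow> \<sigma> x = smult G (sgn_pow a) x"
  using bit_cases[of a] by auto

lemma \<sigma>_h [simp]: "x \<in> h \<Longrightarrow> \<sigma> x \<in> h"
  using B_\<sigma>[of x e0] B_\<sigma>[of x e1] B_\<sigma>[of f0 x] B_\<sigma>[of f1 x] by (intro hI) simp_all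

text \<open>The bracket of the double extension uses the parity involution of \<open>H\<close>, which is a definite description over
  the graded components of \<open>H\<close>; it has to be identified with the one of \<open>G\<close>.\<close>

lemma parity_inv_H: "x \<in> h \<Longrightarrow> parity_inv H x = \<sigma> x"
proof -
  interpret H: quadratic_symplectic H by unfold_locales (rule eqos_H)
  assume "x \<in> h"
  then obtain y z where yz: "y \<in> hgrade 0" "z \<in> hgrade 1" "x = y + z" by (auto simp: carrier_def)
  have "parity_inv H (y + z) = y - z" using H.\<sigma>_sum[of y z] yz by simp
  moreover have "\<sigma> (y + z) = y - z" using yz by (intro \<sigma>_sum) (auto dest: hgrade_grade)
  ultimately show ?thesis using yz by simp
qed

lemma br_e0_e0 [simp]: "br e0 e0 = 0"
proof -
  have "br e0 e0 + br e0 e0 = 0" using br_even[of e0 e0] by (simp add: eq_neg_iff_add_eq_0)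
  then have "smult G 2 (br e0 e0) = 0" by (metis one_add_one scale_left_distrib scale_one)
  then show ?thesis by simp
qed

lemma jacobi_e1: "x \<in> V \<Longrightarrow> br (br e1 e1) x = smult G 2 (br e1 (br e1 x))"
  using jacobi_odd[of e1 e1 x] by (simp add: scale_left_distrib[of 1 1, simplified] eq_diff_eq)

text \<open>The Jacobi identity for three copies of an odd element gives three times this bracket.\<close>

lemma br_e1_cube [simp]: "br e1 (br e1 e1) = 0"
proof -
  have "br e1 (br e1 e1) = - br (br e1 e1) e1" using br_even[of "br e1 e1" e1] by simp
  also have "\<dots> = - smult G 2 (br e1 (br e1 e1))" by (simp add: jacobi_e1)
  finally have "smult G 3 (br e1 (br e1 e1)) = 0"
    using scale_left_distrib[of 2 1 "br e1 (br e1 e1)"] by (simp add: eq_neg_iff_add_eq_0 add.commute)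
  then show ?thesis by simp
qed

text \<open>The values of \<open>\<delta>\<close> and of the bracket on \<open>h\<close> and on the dual plane follow. Their \<open>h\<close>-components are the data by
  definition, and the coefficients of \<open>f0\<close> and \<open>f1\<close> are pairings with \<open>e0\<close> and \<open>e1\<close>, which
  skewness of \<open>\<delta>\<close> and invariance of \<open>B\<close> express by the data.\<close>

lemma \<delta>_e0: "\<delta> e0 = smult G \<alpha> f1 + c1 + smult G lam e1"
  using decomposition[of "\<delta> e0"] \<delta>_skew[of f1 e0] by (simp add: c1_def \<alpha>_def)

lemma \<delta>_e1: "\<delta> e1 = - smult G \<alpha> f0 + c0 - smult G lam e0"
proof -
  have "B (\<delta> e1) e0 = B e1 (\<delta> e0)" using \<delta>_skew[of e1 e0] by simp
  also have "\<dots> = - \<alpha>" by (simp add: \<delta>_e0)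
  finally show ?thesis
    using decomposition[of "\<delta> e1"] \<delta>_skew[of f0 e1] by (simp add: c0_def)
qed

lemma \<delta>_h: "x \<in> h \<Longrightarrow> \<delta> x = - smult G (B c1 x) f0 - smult G (B c0 x) f1 + \<delta>h x"
proof -
  assume x: "x \<in> h"
  have "B (\<delta> x) e0 = - B c1 x"
    using \<delta>_skew[of x e0] x B_\<sigma>[of x c1] B_odd[of c1 x] by (simp add: \<delta>_e0)
  moreover have "B (\<delta> x) e1 = - B c0 x"
    using \<delta>_skew[of x e1] x B_\<sigma>[of x c0] B_even[of c0 x] by (simp add: \<delta>_e1)
  ultimately show ?thesis using decomposition_J[of "\<delta> x"] x by (simp add: \<delta>h_def algebra_simps)
qed

lemma br_e1_e1: "br e1 e1 = smult G k f0 + a0"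
  using decomposition_J[of "br e1 e1"] by (simp add: a0_def k_def)

lemma br_e0_e1: "br e0 e1 = smult G k f1 + a1"
proof -
  have "B (br e0 e1) e1 = k" using B_invariant[of e0 e1 e1] B_even[of e0 "br e1 e1"] by (simp add: k_def)
  then show ?thesis using decomposition_J[of "br e0 e1"] by (simp add: a1_def)
qed

lemma br_e0_h: "x \<in> h \<Longrightarrow> br e0 x = smult G (B a1 x) f1 + D0 x"
proof -
  assume x: "x \<in> h"
  have "br e0 x = - br x e0" using x br_even[of e0 x] by simp
  then have "B (br e0 x) e0 = 0" "B (br e0 x) e1 = B a1 x"
    using x B_invariant[of x e0 e0] B_invariant[of x e0 e1] B_odd[of a1 x] by (simp_all add: br_e0_e1)
  then show ?thesis using decomposition_J[of "br e0 x"] x by (simp add: D0_def)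
qed

lemma br_e1_h: "x \<in> h \<Longrightarrow> br e1 x = smult G (B a1 x) f0 - smult G (B a0 x) f1 + D1 x"
proof -
  assume x: "x \<in> h"
  have "br e1 x = - br (\<sigma> x) e1" using x br_odd[of e1 "\<sigma> x"] by simp
  then have "B (br e1 x) e0 = B a1 x" "B (br e1 x) e1 = - B a0 x"
    using x B_invariant[of "\<sigma> x" e1 e0] B_invariant[of "\<sigma> x" e1 e1] B_odd[of a1 x] B_even[of a0 x]
      br_even[of e0 e1] B_\<sigma>[of x a1] B_\<sigma>[of x a0] by (simp_all add: br_e0_e1 br_e1_e1)
  then show ?thesis using decomposition_J[of "br e1 x"] x by (simp add: D1_def)
qed

lemma D0_skew: "x \<in> h \<Longrightarrow> y \<in> h \<Longrightarrow> B (D0 x) y = - B x (D0 y)"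
proof -
  assume "x \<in> h" "y \<in> h"
  then have "B x (br e0 y) = - B (br e0 x) y" using br_even[of e0 x] B_invariant[of x e0 y] by simp
  then show ?thesis using \<open>x \<in> h\<close> \<open>y \<in> h\<close> by (simp add: D0_def)
qed

lemma D1_skew: "x \<in> h \<Longrightarrow> y \<in> h \<Longrightarrow> B (D1 x) y = - B (\<sigma> x) (D1 y)"
proof -
  assume "x \<in> h" "y \<in> h"
  then have "B (\<sigma> x) (br e1 y) = - B (br e1 x) y"
    using br_odd[of e1 "\<sigma> x"] B_invariant[of "\<sigma> x" e1 y] by simp
  then show ?thesis using \<open>x \<in> h\<close> \<open>y \<in> h\<close> by (simp add: D1_def)
qed

lemma br_h_h: 
  assumes x: "x \<in> h" and y: "y \<in> h"
  shows "br x y = smult G (B (D0 x) y) f0 - smult G (B (D1 x) y) f1 + proj (br x y)"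
proof -
  have "B (br x y) e0 = B (D0 x) y"
    using x y B_invariant[of x y e0] br_even[of e0 y] D0_skew[of x y] by (simp add: D0_def)
  moreover have "B (br x y) e1 = - B (D1 x) y"
  proof -
    have "B (br x y) e1 = - B x (br e1 (\<sigma> y))" using x y B_invariant[of x y e1] br_odd[of e1 y] by simp
    also have "br e1 (\<sigma> y) = - \<sigma> (br e1 y)" using y br_\<sigma>[of e1 y] by simp
    also have "- B x (- \<sigma> (br e1 y)) = B (\<sigma> x) (br e1 y)" using x y B_\<sigma>[of x "br e1 y"] by simp
    also have "\<dots> = - B (D1 x) y" using D1_skew[OF x y] x y by (simp add: D1_def)
    finally show ?thesis .
  qed
  ultimately show ?thesis using decomposition_J[of "br x y"] x y by simp
qed

lemma associated_\<delta>h: "associated_superderivation H \<delta>h"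
  unfolding associated_superderivation_def superderivation_def
proof (intro conjI allI ballI)
  show "linear_on (smult H) (smult H) h \<delta>h" by (simp add: linear_on_def \<delta>h_def)
  show "\<delta>h ` grade H a \<subseteq> grade H (a + 1)" for a
    unfolding \<delta>h_def H_sel by (intro image_subsetI proj_grade \<delta>_grade hgrade_grade)
  show "\<delta>h (bracket H x y) = bracket H (\<delta>h x) y + smult H (sgn_pow (1 * a)) (bracket H x (\<delta>h y))"
    if x: "x \<in> grade H a" and y: "y \<in> h" for a x y
  proof -
    have "x \<in> grade G a" "x \<in> h" using x by (auto intro: hgrade_grade hgrade_h)
    then show ?thesis using \<delta>_br_homogeneous[of x a y] y by (simp add: \<delta>h_def)
  qed
  show "bij_betw \<delta>h h h"
    unfolding bij_betw_def
  proof
    show "inj_on \<delta>h h"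
    proof (rule inj_onI)
      fix x y assume xy: "x \<in> h" "y \<in> h" "\<delta>h x = \<delta>h y"
      then have "\<delta>h (x - y) = 0" by (simp add: \<delta>h_def)
      then show "x = y" using \<delta>h_inj[of "x - y"] xy by simp
    qed
    show "\<delta>h ` h = h"
    proof
      show "\<delta>h ` h \<subseteq> h" by (auto simp: \<delta>h_def)
      show "h \<subseteq> \<delta>h ` h" using \<delta>h_surj by blast
    qed
  qed
  show "sform H x y = qform H (\<delta>h x) y" if "x \<in> h" "y \<in> h" for x y using \<omega>_\<delta>h that by simp
qed

lemma superderivation_D0: "superderivation H 0 D0"
  unfolding superderivation_def
proof (intro conjI allI ballI)
  show "linear_on (smult H) (smult H) h D0" by (simp add: linear_on_def D0_def)
  show "D0 ` grade H a \<subseteq> grade H (a + 0)" for a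
  proof
    fix z assume "z \<in> D0 ` grade H a"
    then obtain x where "x \<in> grade G a" "z = proj (br e0 x)" by (auto simp: D0_def dest: hgrade_grade)
    then show "z \<in> grade H (a + 0)"
      using proj_grade[OF br_grade[OF parities(3)], of x a] by (simp only: H_sel add_0 add.right_neutral)
  qed
  show "D0 (bracket H x y) = bracket H (D0 x) y + smult H (sgn_pow (0 * a)) (bracket H x (D0 y))"
    if x: "x \<in> grade H a" and y: "y \<in> h" for a x y
  proof -
    have "x \<in> h" using x by (auto intro: hgrade_h)
    then show ?thesis using jacobi_even[of e0 x y] y by (simp add: D0_def)
  qed
qed

lemma superderivation_D1: "superderivation H 1 D1"
  unfolding superderivation_def
proof (intro conjI allI ballI)
  show "linear_on (smult H) (smult H) h D1" by (simp add: linear_on_def D1_def)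
  show "D1 ` grade H a \<subseteq> grade H (a + 1)" for a
  proof
    fix z assume "z \<in> D1 ` grade H a"
    then obtain x where "x \<in> grade G a" "z = proj (br e1 x)" by (auto simp: D1_def dest: hgrade_grade)
    then show "z \<in> grade H (a + 1)"
      using proj_grade[OF br_grade[OF parities(4)], of x a] by (simp only: H_sel add.commute)
  qed
  show "D1 (bracket H x y) = bracket H (D1 x) y + smult H (sgn_pow (1 * a)) (bracket H x (D1 y))"
    if x: "x \<in> grade H a" and y: "y \<in> h" for a x y
  proof -
    have "x \<in> h" "x \<in> grade G a" using x by (auto intro: hgrade_h hgrade_grade)
    then show ?thesis using jacobi_odd[of e1 x y] y \<sigma>_grade[of x a] by (simp add: D1_def)
  qed
qed

text \<open>Each condition is the projection of an identity in \<open>G\<close>: those between \<open>D0\<close>, \<open>D1\<close>, \<open>a0\<close>, \<open>a1\<close> come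
  from Jacobi identities with two or three arguments among \<open>e0\<close>, \<open>e1\<close>, those that involve \<open>\<delta>\<close> from the
  derivation rule for \<open>[e\<^sub>i, x]\<close> and \<open>[e\<^sub>i, e\<^sub>j]\<close>. The two scalar conditions use
  invariance: \<open>B(a0, a0) = B(e1, [e1, [e1, e1]]) = 0\<close>, and \<open>\<lambda> k = B(c0, a0)\<close> says that \<open>\<delta> e1\<close> is orthogonal
  to \<open>[e1, e1]\<close>.\<close>

theorem data_H: "double_extension_data H \<delta>h D0 D1 a0 a1 c0 c1 k lam"
  unfolding double_extension_data_def
proof (intro conjI ballI)
  show "even_quadratic_odd_symplectic H" by (rule eqos_H)
  show "associated_superderivation H \<delta>h" by (rule associated_\<delta>h)
  show "superderivation H 0 D0" by (rule superderivation_D0)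
  show "superderivation H 1 D1" by (rule superderivation_D1)
  show "skew_supersymmetric_map H 0 D0"
    unfolding skew_supersymmetric_map_def using D0_skew by (auto dest: hgrade_h)
  show "skew_supersymmetric_map H 1 D1"
    unfolding skew_supersymmetric_map_def
  proof (intro allI ballI)
    fix a x y assume x: "x \<in> grade H a" and y: "y \<in> h"
    have "x \<in> h" "x \<in> grade G a" using x by (auto intro: hgrade_h hgrade_grade)
    then show "qform H (D1 x) y = - sgn_pow (1 * a) * qform H x (D1 y)"
      using D1_skew[of x y] y \<sigma>_grade[of x a] by simp
  qed
  show "a0 \<in> grade H 0" "c0 \<in> grade H 0" "a1 \<in> grade H 1" "c1 \<in> grade H 1"
    using data_hgrade by simp_all
  show "lam \<noteq> 0" by (rule lam)
  show "D1 (D1 x) = smult H (1 / 2) (bracket H a0 x)" if "x \<in> h" for x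
    using that jacobi_e1[of x] by (simp add: D1_def a0_def)
  show "D1 a0 = 0" by (simp add: D1_def a0_def)
  show "qform H a0 a0 = 0"
  proof -
    have "B a0 a0 = B (br e1 e1) a0" using B_proj(1)[of "br e1 e1" a0] by (simp flip: a0_def)
    also have "\<dots> = B (br e1 e1) (br e1 e1)" by (simp add: a0_def B_J_proj)
    also have "\<dots> = 0" using B_invariant[of e1 e1 "br e1 e1"] by simp
    finally show ?thesis by simp
  qed
  show "supercommutator H 0 1 D0 D1 x = bracket H a1 x" if "x \<in> h" for x
    using that jacobi_even[of e0 e1 x] by (simp add: supercommutator_def D0_def D1_def a1_def)
  show "D0 a0 = smult H 2 (D1 a1)"
    using jacobi_even[of e0 e1 e1] br_odd[of e1 "br e0 e1"]
    by (simp add: D0_def D1_def a0_def a1_def scale_left_distrib[of 1 1, simplified])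
  show "supercommutator H 1 0 \<delta>h D0 x - smult H lam (D1 x) = bracket H c1 x" if "x \<in> h" for x
    using that \<delta>_br[of e0 x] by (simp add: supercommutator_def D0_def D1_def \<delta>h_def \<delta>_e0)
  show "supercommutator H 1 1 \<delta>h D1 x + smult H lam (D0 x) = bracket H c0 x" if "x \<in> h" for x
    using that \<delta>_br[of e1 x] by (simp add: supercommutator_def D0_def D1_def \<delta>h_def \<delta>_e1)
  show "\<delta>h a0 = - smult H (2 * lam) a1 - smult H 2 (D1 c0)"
  proof -
    have "\<delta> (br e1 e1) = smult G (- 2) (br e1 (\<delta> e1))"
      using \<delta>_br[of e1 e1] br_even[of "\<delta> e1" e1] scale_left_distrib[of 1 1 "br e1 (\<delta> e1)"]
      by simp
    also have "br e1 (\<delta> e1) = br e1 c0 + smult G lam (br e0 e1)"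
      using br_even[of e0 e1] by (simp add: \<delta>_e1)
    finally have "\<delta> (br e1 e1) = - smult G (2 * lam) (br e0 e1) - smult G 2 (br e1 c0)"
      by (simp add: scale_right_distrib)
    then show ?thesis by (simp add: a0_def a1_def \<delta>h_def D1_def)
  qed
  show "\<delta>h a1 = smult H lam a0 + D0 c0 + D1 c1"
  proof -
    have "\<delta> (br e0 e1) = smult G lam (br e1 e1) + br e0 c0 + br e1 c1"
      using \<delta>_br[of e0 e1] br_odd[of e1 c1] by (simp add: \<delta>_e0 \<delta>_e1 algebra_simps)
    then show ?thesis by (simp add: a0_def a1_def \<delta>h_def D0_def D1_def)
  qed
  show "lam * k = qform H c0 a0"
  proof -
    \<comment> \<open>The pairing \<open>B (\<delta> e1) ?E\<close> equals minus twice itself: once by skewness of \<open>\<delta>\<close>, once by the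
      derivation rule for \<open>\<delta> ?E\<close>.\<close>
    let ?E = "br e1 e1"
    have "B (\<delta> ?E) e1 = - B ?E (\<delta> e1)" using \<delta>_skew[of ?E e1] by simp
    moreover have "\<delta> ?E = br (\<delta> e1) e1 + br (\<delta> e1) e1"
      using \<delta>_br[of e1 e1] br_even[of "\<delta> e1" e1] by simp
    then have "B (\<delta> ?E) e1 = 2 * B (\<delta> e1) ?E"
      by (simp add: B_invariant)
    moreover have "B ?E (\<delta> e1) = B (\<delta> e1) ?E" using B_even[of "\<delta> e1" ?E] by simp
    ultimately have "3 * B (\<delta> e1) ?E = 0" by simp
    then have "B (\<delta> e1) ?E = 0" by simp
    moreover have "B (\<delta> e1) ?E = B c0 ?E - lam * B e0 ?E" by (simp add: \<delta>_e1)
    moreover have "B e0 ?E = k" using B_even[of e0 ?E] by (simp add: k_def)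
    ultimately show ?thesis by (simp add: a0_def B_J_proj)
  qed
qed

fun frame_map :: "('k, 'v) ext \<Rightarrow> 'v" where
  "frame_map (a, b, x, p, q) = smult G a f0 + smult G b f1 + x + smult G p e0 + smult G q e1"

abbreviation "Ext \<equiv> double_extension H \<delta>h D0 D1 a0 a1 c0 c1 k \<alpha> lam"

lemma ext_sel [simp]: "smult Ext = ext_smult (smult G)" "grade Ext = ext_grade H"
    "bracket Ext = ext_bracket H D0 D1 a0 a1 k" "qform Ext = ext_qform H"
    "sform Ext s t = ext_qform H (ext_Delta H \<delta>h c0 c1 \<alpha> lam s) t"
  by (simp_all add: double_extension_def)

lemma carrier_ext: "carrier Ext = {(a, b, x, p, q) | a b x p q. x \<in> h}"
proof
  show "carrier Ext \<subseteq> {(a, b, x, p, q) | a b x p q. x \<in> h}"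
    unfolding carrier_def[of Ext] ext_sel ext_grade_def by (auto dest!: hgrade_h)
  show "{(a, b, x, p, q) | a b x p q. x \<in> h} \<subseteq> carrier Ext"
  proof clarify
    fix a b p q :: 'k and x assume "x \<in> h"
    then obtain y z where yz: "y \<in> hgrade 0" "z \<in> hgrade 1" "x = y + z" by (auto simp: carrier_def)
    have "(a, b, x, p, q) = (a, 0, y, p, 0) + (0, b, z, 0, q)" using yz by simp
    moreover have "(a, 0, y, p, 0) \<in> grade Ext 0" "(0, b, z, 0, q) \<in> grade Ext 1"
      using yz by (auto simp: ext_grade_def)
    ultimately show "(a, b, x, p, q) \<in> carrier Ext" unfolding carrier_def by blast
  qed
qed

lemma frame_map_coordinates:
  assumes "x \<in> h"
  shows "B (frame_map (a, b, x, p, q)) e0 = a" "B (frame_map (a, b, x, p, q)) e1 = b"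
    "B f0 (frame_map (a, b, x, p, q)) = p" "B f1 (frame_map (a, b, x, p, q)) = q"
    "proj (frame_map (a, b, x, p, q)) = x"
  using assms by simp_all

lemma frame_map_bracket:
  assumes x: "x \<in> h" and y: "y \<in> h"
  shows "frame_map (ext_bracket H D0 D1 a0 a1 k (a, b, x, p, q) (a', b', y, p', q')) =
    br (frame_map (a, b, x, p, q)) (frame_map (a', b', y, p', q'))"
proof -
  have e: "br x e0 = - br e0 x" "br x e1 = - br e1 (\<sigma> x)" "br e1 e0 = - br e0 e1"
    using x br_even[of e0 x] br_odd[of e1 x] br_even[of e0 e1] by simp_all
  have "br (frame_map (a, b, x, p, q)) (frame_map (a', b', y, p', q')) =
      br x y + smult G p (br e0 y) + smult G q (br e1 y) - smult G p' (br e0 x)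
      - smult G q' (br e1 (\<sigma> x)) + smult G (q * q') (br e1 e1) + smult G (p * q' - q * p') (br e0 e1)"
    using x y by (simp add: e scale_right_distrib scale_right_diff_distrib scale_left_diff_distrib
        mult.commute algebra_simps)
  also have "\<dots> = frame_map (ext_bracket H D0 D1 a0 a1 k (a, b, x, p, q) (a', b', y, p', q'))"
    unfolding br_e0_e1 br_e1_e1 br_e0_h[OF x] br_e0_h[OF y] br_e1_h[OF y] br_e1_h[OF \<sigma>_h[OF x]]
    by (subst br_h_h[OF x y], use x y in \<open>simp add: Let_def zero_prod_def parity_inv_H
        scale_right_distrib scale_right_diff_distrib scale_left_distrib scale_left_diff_distrib
        algebra_simps\<close>)
  finally show ?thesis by simp
qed

lemma frame_map_Delta:
  assumes x: "x \<in> h"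
  shows "frame_map (ext_Delta H \<delta>h c0 c1 \<alpha> lam (a, b, x, p, q)) = \<delta> (frame_map (a, b, x, p, q))"
  using x by (simp add: Let_def \<delta>_h \<delta>_e0 \<delta>_e1 scale_right_distrib scale_right_diff_distrib
        scale_left_distrib scale_left_diff_distrib mult.commute algebra_simps)

lemma frame_map_qform:
  assumes x: "x \<in> h" and y: "y \<in> h"
  shows "B (frame_map (a, b, x, p, q)) (frame_map (a', b', y, p', q')) =
    ext_qform H (a, b, x, p, q) (a', b', y, p', q')"
  using x y by (simp add: algebra_simps)

text \<open>Brackets and \<open>\<Omega>\<close> match because the multiplication table of the frame and of \<open>h\<close> in \<open>G\<close>, and the
  values of \<open>\<delta>\<close> on them, are those that define the extension.\<close>

theorem frame_map_isometric: "isometric_isomorphism Ext G frame_map"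
  unfolding isometric_isomorphism_def
proof (intro conjI allI ballI)
  show "linear_on (smult Ext) (smult G) (carrier Ext) frame_map"
    by (auto simp: linear_on_def carrier_ext scale_right_distrib scale_left_distrib algebra_simps)
  show "bij_betw frame_map (carrier Ext) V"
    unfolding bij_betw_def
  proof
    show "inj_on frame_map (carrier Ext)"
    proof (rule inj_onI)
      fix s t assume st: "s \<in> carrier Ext" "t \<in> carrier Ext" "frame_map s = frame_map t"
      obtain a b x p q where s: "s = (a, b, x, p, q)" "x \<in> h" using st(1) by (auto simp: carrier_ext)
      obtain a' b' x' p' q' where t: "t = (a', b', x', p', q')" "x' \<in> h" using st(2) by (auto simp: carrier_ext)
      show "s = t"
        using frame_map_coordinates[OF s(2), of a b p q] frame_map_coordinates[OF t(2), of a' b' p' q']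
          st(3) unfolding s(1) t(1) by metis
    qed
    show "frame_map ` carrier Ext = V"
    proof
      show "frame_map ` carrier Ext \<subseteq> V" by (auto simp: carrier_ext)
      show "V \<subseteq> frame_map ` carrier Ext"
      proof
        fix x assume x: "x \<in> V"
        have "x = frame_map (B x e0, B x e1, proj x, B f0 x, B f1 x)"
          using decomposition[of x] by simp
        moreover have "(B x e0, B x e1, proj x, B f0 x, B f1 x) \<in> carrier Ext"
          using x by (simp add: carrier_ext)
        ultimately show "x \<in> frame_map ` carrier Ext" by blast
      qed
    qed
  qed
  show "frame_map ` grade Ext a \<subseteq> grade G a" for a
    using bit_cases[of a] by (auto simp: ext_grade_def dest: hgrade_grade)
  fix s t assume st: "s \<in> carrier Ext" "t \<in> carrier Ext"
  obtain a b x p q where s: "s = (a, b, x, p, q)" "x \<in> h" using st(1) by (auto simp: carrier_ext)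
  obtain a' b' y p' q' where t: "t = (a', b', y, p', q')" "y \<in> h" using st(2) by (auto simp: carrier_ext)
  show "frame_map (bracket Ext s t) = br (frame_map s) (frame_map t)"
    unfolding s(1) t(1) ext_sel using frame_map_bracket[OF s(2) t(2)] .
  show "B (frame_map s) (frame_map t) = qform Ext s t"
    unfolding s(1) t(1) ext_sel using frame_map_qform[OF s(2) t(2)] .
  obtain a'' b'' z p'' q'' where d: "ext_Delta H \<delta>h c0 c1 \<alpha> lam s = (a'', b'', z, p'', q'')" "z \<in> h"
    using s by (auto simp: Let_def)
  have "\<omega> (frame_map s) (frame_map t) = B (\<delta> (frame_map s)) (frame_map t)"
    using s t by (intro \<omega>_\<delta>) auto
  also have "\<dots> = B (frame_map (ext_Delta H \<delta>h c0 c1 \<alpha> lam s)) (frame_map t)"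
    unfolding s(1) frame_map_Delta[OF s(2)] ..
  also have "\<dots> = sform Ext s t"
    unfolding d(1) t(1) ext_sel using frame_map_qform[OF d(2) t(2)] d(1) s(1) by simp
  finally show "\<omega> (frame_map s) (frame_map t) = sform Ext s t" .
qed

lemma h_smaller: "h \<subset> V"
proof -
  have "f0 \<notin> h" by (simp add: h_iff)
  then show ?thesis using h_V V0_V[OF parities(1)] by blast
qed

end

section \<open>Induction on the dimension\<close>

context quadratic_symplectic_closed
begin

text \<open>Nondegeneracy supplies dual vectors of the right degree. The even one is corrected by a multiple
  of \<open>f0\<close> to become isotropic, which does not change its pairing with the isotropic vector \<open>f0\<close>; the
  odd one is isotropic by supersymmetry.\<close>

theorem hyperbolic_frame_exists:
  assumes "V \<noteq> {0}"
  shows "\<exists>f0 f1 e0 e1 lam. hyperbolic_frame G \<delta> f0 f1 e0 e1 lam"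
proof -
  obtain f0 lam where f0: "f0 \<in> V0" "f0 \<noteq> 0" "central f0" "lam \<noteq> 0" "\<delta> (\<delta> f0) = smult G (lam * lam) f0"
    using central_eigenvector[OF assms] .
  define f1 where "f1 = smult G (1 / lam) (\<delta> f0)"
  have f1: "f1 \<in> V1" "\<delta> f0 = smult G lam f1" "\<delta> f1 = smult G lam f0"
    using f0 by (simp_all add: f1_def)
  have c1: "central f1"
    using central_\<delta>[OF f0(3)] by (simp add: central_def f1_def)
  have "f1 \<noteq> 0" using f1(2) f0 \<delta>_eq_0[of f0] by auto
  have dual: "\<exists>v\<in>grade G a. B u v = 1" if u: "u \<in> grade G a" "u \<noteq> 0" for u a
  proof -
    obtain v where v: "v \<in> V" "B u v \<noteq> 0" using B_nondegenerate[of u] u grade_V by blast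
    obtain v0 v1 where d: "v0 \<in> V0" "v1 \<in> V1" "v = v0 + v1" using V_cases[OF v(1)] .
    have "\<exists>w\<in>grade G a. B u w \<noteq> 0" using bit_cases[of a] u v d by auto
    then obtain w where w: "w \<in> grade G a" "B u w \<noteq> 0" by blast
    then have "B u (smult G (1 / B u w) w) = 1" using u by (simp add: grade_V)
    then show ?thesis using w(1) by (intro bexI[of _ "smult G (1 / B u w) w"]) auto
  qed
  obtain u where u: "u \<in> V0" "B f0 u = 1" using dual[of f0 0] f0 by auto
  obtain e1 where e1: "e1 \<in> V1" "B f1 e1 = 1" using dual[of f1 1] f1 \<open>f1 \<noteq> 0\<close> by auto
  have ff: "B f0 f0 = 0" using isotropic_eigenvector[OF f0(1) f1 f0(4)] .
  define e0 where "e0 = u - smult G (B u u / 2) f0"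
  have "B u f0 = 1" using B_even[of f0 u] u f0(1) by simp
  then have e0: "e0 \<in> V0" "B f0 e0 = 1" "B e0 e0 = 0"
    using u f0(1) ff by (simp_all add: e0_def)
  have "hyperbolic_frame G \<delta> f0 f1 e0 e1 lam"
    using f0 f1 c1 e0 e1 by unfold_locales auto
  then show ?thesis by blast
qed

end

text \<open>The core \<open>H\<close> is a proper subspace, so its dimension is smaller.\<close>

theorem corollary5p6:
  fixes G :: "('k::{alg_closed_field, field_char_0}, 'v::ab_group_add) qs_superalgebra"
  assumes "even_quadratic_odd_symplectic G"
    and "carrier G \<noteq> {0}"
  shows "obtained_from_zero G"
  using assms
proof (induction "vector_space.dim (smult G) (carrier G)" arbitrary: G rule: less_induct)
  case (less G)
  interpret quadratic_symplectic G by unfold_locales (rule less.prems(1))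
  obtain \<delta> where "associated_superderivation G \<delta>" using associated_superderivation_exists by blast
  then interpret quadratic_symplectic_closed G \<delta> by unfold_locales
  obtain f0 f1 e0 e1 lam where "hyperbolic_frame G \<delta> f0 f1 e0 e1 lam"
    using hyperbolic_frame_exists[OF less.prems(2)] by blast
  then interpret hyperbolic_frame G \<delta> f0 f1 e0 e1 lam .
  have "obtained_from_zero H"
  proof (cases "carrier H = {0}")
    case True
    then show ?thesis using obtained_from_zero.zero[OF eqos_H] by simp
  next
    case False
    obtain A where A: "finite A" "V \<subseteq> span A" using finite_spanning .
    have "dim h < dim V" using dim_strict_mono[OF A subspace_h h_smaller] .
    then show ?thesis using less.hyps[of H] eqos_H False by simp
  qed
  then show ?case
    using obtained_from_zero.extend[OF _ data_H less.prems(1) frame_map_isometric] by blast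
qed

end
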